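(* Let $(X,\sigma)$ be a multivariable dynamical system with $n$ maps. Let $\pi$ be a $*$-representation of $\mathrm{C}_0(X)$ on a Hilbert space $\mathcal{H}$, and let $A=[A_1\ \cdots\ A_n]$ be a row contraction of operators on $\mathcal{H}$ (i.e. $\|A\|\le 1$) satisfying the covariance relations \[ \pi(f)A_i=A_i\pi(f\circ\sigma_i)\quad\text{for } f\in\mathrm{C}_0(X),\ 1\le i\le n. \] Then there is a Hilbert space $\mathcal{K}$ containing $\mathcal{H}$, a $*$-representation $\rho$ of $\mathrm{C}_0(X)$ on $\mathcal{K}$ and a row isometry $[S_1\ \cdots\ S_n]$ of operators on $\mathcal{K}$ such that \begin{enumerate} \item[(i)] $\rho(f)S_i=S_i\rho(f\circ\sigma_i)$ for $f\in\mathrm{C}_0(X)$ and $1\le i\le n$. \item[(ii)] $\mathcal{H}$ reduces $\rho$ and $\rho(f)|_{\mathcal{H}}=\pi(f)$ for $f\in\mathrm{C}_0(X)$. \item[(iii)] $\mathcal{H}^\perp$ is invariant for each $S_i$, and $P_{\mathcal{H}}S_i|_{\mathcal{H}}=A_i$ for $1\le i\le n$. \end{enumerate}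
   Context: A multivariable dynamical system $(X,\sigma)$ is a locally compact Hausdorff space $X$ together with $n\ge1$ proper continuous maps $\sigma_1,\dots,\sigma_n$ of $X$ into itself. A row isometry is a row $[S_1\ \cdots\ S_n]$ that is an isometry from $\mathcal{K}^{(n)}$ to $\mathcal{K}$, i.e. $S_i^*S_j=\delta_{ij}I$. $P_{\mathcal{H}}$ is the orthogonal projection onto $\mathcal{H}$. *)

theory Defs
  imports "HOL-Analysis.Analysis" "HOL-Library.Function_Algebras"
begin

text \<open>
  Hilbert spaces have explicit carriers, so that they can be quantified over existentially:
  the vectors form a subset \<open>vecs H\<close> of a type of class \<open>ab_group_add\<close>, which supplies the
  addition. Inner products are linear in the first argument. Conditions on operators only
  concern their values on the carrier.
\<close>

record 'a hilbert =
  vecs :: "'a set"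
  scl :: "complex \<Rightarrow> 'a \<Rightarrow> 'a"
  ip :: "'a \<Rightarrow> 'a \<Rightarrow> complex"

definition hnorm :: "('a, 'more) hilbert_scheme \<Rightarrow> 'a \<Rightarrow> real" where
  "hnorm H x = sqrt (Re (ip H x x))"

locale complex_hilbert_space =
  fixes H :: "'a::ab_group_add hilbert"
  assumes vector_space: "vector_space (scl H)"
    and subspace: "module.subspace (scl H) (vecs H)"
    and ip_add: "\<lbrakk>x \<in> vecs H; y \<in> vecs H; z \<in> vecs H\<rbrakk> \<Longrightarrow> ip H (x + y) z = ip H x z + ip H y z"
    and ip_scl: "\<lbrakk>x \<in> vecs H; y \<in> vecs H\<rbrakk> \<Longrightarrow> ip H (scl H c x) y = c * ip H x y"
    and ip_cnj: "\<lbrakk>x \<in> vecs H; y \<in> vecs H\<rbrakk> \<Longrightarrow> ip H y x = cnj (ip H x y)"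
    and ip_nonneg: "x \<in> vecs H \<Longrightarrow> 0 \<le> Re (ip H x x)"
    and ip_definite: "\<lbrakk>x \<in> vecs H; ip H x x = 0\<rbrakk> \<Longrightarrow> x = 0"
    and complete: "Metric_space.mcomplete (vecs H) (\<lambda>x y. hnorm H (x - y))"

definition linear_between ::
  "'a::ab_group_add hilbert \<Rightarrow> 'b::ab_group_add hilbert \<Rightarrow> ('a \<Rightarrow> 'b) \<Rightarrow> bool" where
  "linear_between H K T \<longleftrightarrow>
     T \<in> vecs H \<rightarrow> vecs K \<and>
     (\<forall>x\<in>vecs H. \<forall>y\<in>vecs H. T (x + y) = T x + T y) \<and>
     (\<forall>c. \<forall>x\<in>vecs H. T (scl H c x) = scl K c (T x))"

definition bounded_operator :: "'a::ab_group_add hilbert \<Rightarrow> ('a \<Rightarrow> 'a) \<Rightarrow> bool" where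
  "bounded_operator H T \<longleftrightarrow>
     linear_between H H T \<and> (\<exists>B. \<forall>x\<in>vecs H. hnorm H (T x) \<le> B * hnorm H x)"

text \<open>
  A Hilbert space \<open>K\<close> containing \<open>H\<close> is a \<open>K\<close> with an isometric embedding \<open>J\<close> of \<open>H\<close>, and \<open>H\<close> is
  identified with \<open>J ` vecs H\<close>.
\<close>

definition isometric_embedding ::
  "'a::ab_group_add hilbert \<Rightarrow> 'b::ab_group_add hilbert \<Rightarrow> ('a \<Rightarrow> 'b) \<Rightarrow> bool" where
  "isometric_embedding H K J \<longleftrightarrow>
     linear_between H K J \<and> (\<forall>x\<in>vecs H. \<forall>y\<in>vecs H. ip K (J x) (J y) = ip H x y)"

definition orth_compl :: "'a::ab_group_add hilbert \<Rightarrow> 'a set \<Rightarrow> 'a set" where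
  "orth_compl K M = {x \<in> vecs K. \<forall>y\<in>M. ip K x y = 0}"

definition orth_proj :: "'a::ab_group_add hilbert \<Rightarrow> 'a set \<Rightarrow> 'a \<Rightarrow> 'a" where
  "orth_proj K M x = (THE y. y \<in> M \<and> x - y \<in> orth_compl K M)"

definition invariant_under :: "'a set \<Rightarrow> ('a \<Rightarrow> 'a) \<Rightarrow> bool" where
  "invariant_under M T \<longleftrightarrow> T ` M \<subseteq> M"

text \<open>
  An element of \<open>H\<^sup>(\<^sup>n\<^sup>)\<close> is a family \<open>x \<in> {1..n} \<rightarrow> vecs H\<close>; only its values on \<open>{1..n}\<close> matter.
\<close>

definition column_norm :: "'a::ab_group_add hilbert \<Rightarrow> nat \<Rightarrow> (nat \<Rightarrow> 'a) \<Rightarrow> real" where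
  "column_norm H n x = sqrt (\<Sum>i\<in>{1..n}. (hnorm H (x i))\<^sup>2)"

definition row_apply :: "nat \<Rightarrow> (nat \<Rightarrow> 'a \<Rightarrow> 'a) \<Rightarrow> (nat \<Rightarrow> 'a) \<Rightarrow> 'a::ab_group_add" where
  "row_apply n A x = (\<Sum>i\<in>{1..n}. A i (x i))"

definition row_opnorm :: "'a::ab_group_add hilbert \<Rightarrow> nat \<Rightarrow> (nat \<Rightarrow> 'a \<Rightarrow> 'a) \<Rightarrow> real" where
  "row_opnorm H n A =
     (SUP x \<in> {x \<in> {1..n} \<rightarrow> vecs H. column_norm H n x \<le> 1}. hnorm H (row_apply n A x))"

definition row_contraction :: "'a::ab_group_add hilbert \<Rightarrow> nat \<Rightarrow> (nat \<Rightarrow> 'a \<Rightarrow> 'a) \<Rightarrow> bool" where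
  "row_contraction H n A \<longleftrightarrow>
     (\<forall>i\<in>{1..n}. bounded_operator H (A i)) \<and> row_opnorm H n A \<le> 1"

definition row_isometry :: "'a::ab_group_add hilbert \<Rightarrow> nat \<Rightarrow> (nat \<Rightarrow> 'a \<Rightarrow> 'a) \<Rightarrow> bool" where
  "row_isometry K n S \<longleftrightarrow>
     (\<forall>i\<in>{1..n}. bounded_operator K (S i)) \<and>
     (\<forall>x \<in> {1..n} \<rightarrow> vecs K. hnorm K (row_apply n S x) = column_norm K n x)"

locale multivariable_dynamical_system =
  fixes X :: "'x topology" and n :: nat and \<sigma> :: "nat \<Rightarrow> 'x \<Rightarrow> 'x"
  assumes locally_compact: "locally_compact_space X"
    and Hausdorff: "Hausdorff_space X"
    and n_pos: "1 \<le> n"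
    and continuous: "i \<in> {1..n} \<Longrightarrow> continuous_map X X (\<sigma> i)"
    and proper: "i \<in> {1..n} \<Longrightarrow> proper_map X X (\<sigma> i)"

text \<open>
  A function on the space \<open>X\<close> is represented by its extension by \<open>0\<close> to the whole type, so that
  equality in \<open>C0 X\<close> is equality of HOL functions; hence the case distinction in \<open>pullback\<close>,
  which is composition with \<open>s\<close>.
\<close>

definition C0 :: "'x topology \<Rightarrow> ('x \<Rightarrow> complex) set" where
  "C0 X = {f. continuous_map X euclidean f \<and>
              (\<forall>\<epsilon>>0. compactin X {x \<in> topspace X. \<epsilon> \<le> cmod (f x)}) \<and>
              (\<forall>x. x \<notin> topspace X \<longrightarrow> f x = 0)}"

definition pullback :: "'x topology \<Rightarrow> ('x \<Rightarrow> complex) \<Rightarrow> ('x \<Rightarrow> 'x) \<Rightarrow> 'x \<Rightarrow> complex" where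
  "pullback X f s = (\<lambda>x. if x \<in> topspace X then f (s x) else 0)"

text \<open>A representation is not required to be nondegenerate.\<close>

definition star_representation ::
  "'x topology \<Rightarrow> 'a::ab_group_add hilbert \<Rightarrow> (('x \<Rightarrow> complex) \<Rightarrow> 'a \<Rightarrow> 'a) \<Rightarrow> bool" where
  "star_representation X H \<pi> \<longleftrightarrow>
     (\<forall>f\<in>C0 X. bounded_operator H (\<pi> f)) \<and>
     (\<forall>f\<in>C0 X. \<forall>g\<in>C0 X. \<forall>x\<in>vecs H. \<pi> (\<lambda>t. f t + g t) x = \<pi> f x + \<pi> g x) \<and>
     (\<forall>c. \<forall>f\<in>C0 X. \<forall>x\<in>vecs H. \<pi> (\<lambda>t. c * f t) x = scl H c (\<pi> f x)) \<and>
     (\<forall>f\<in>C0 X. \<forall>g\<in>C0 X. \<forall>x\<in>vecs H. \<pi> (\<lambda>t. f t * g t) x = \<pi> f (\<pi> g x)) \<and>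
     (\<forall>f\<in>C0 X. \<forall>x\<in>vecs H. \<forall>y\<in>vecs H. ip H (\<pi> f x) y = ip H x (\<pi> (\<lambda>t. cnj (f t)) y))"

definition covariant ::
  "'x topology \<Rightarrow> nat \<Rightarrow> (nat \<Rightarrow> 'x \<Rightarrow> 'x) \<Rightarrow> 'a::ab_group_add hilbert \<Rightarrow>
   (('x \<Rightarrow> complex) \<Rightarrow> 'a \<Rightarrow> 'a) \<Rightarrow> (nat \<Rightarrow> 'a \<Rightarrow> 'a) \<Rightarrow> bool" where
  "covariant X n \<sigma> H \<pi> A \<longleftrightarrow>
     (\<forall>f\<in>C0 X. \<forall>i\<in>{1..n}. \<forall>x\<in>vecs H. \<pi> f (A i x) = A i (\<pi> (pullback X f (\<sigma> i)) x))"

end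

theory Submission
  imports Defs "HOL-Library.Groups_Big_Fun" "HOL-Library.Nat_Bijection"
begin

text \<open>
  Write \<open>F\<close> for the Fock space with orthonormal basis \<open>e\<^sub>w\<close>, where \<open>w\<close> runs over the words in
  \<open>1, \<dots>, n\<close>. The minimal isometric dilation of a row contraction \<open>A\<close> acts on
  \<open>H \<oplus> (F \<otimes> D)\<close>, where \<open>D\<close> is the closure of the range of the defect operator
  \<open>(I - A\<^sup>* A)\<^sup>1\<^sup>/\<^sup>2\<close> on \<open>H\<^sup>(\<^sup>n\<^sup>)\<close>: the isometry \<open>S\<^sub>i\<close> sends \<open>h \<in> H\<close> to \<open>A\<^sub>i h\<close> plus the defect operator
  applied to \<open>h\<close> in the \<open>i\<close>-th place, and it shifts \<open>e\<^sub>w\<close> to \<open>e\<^sub>i\<^sub>w\<close>.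

  The space \<open>D\<close> is also the completion of \<open>H\<^sup>(\<^sup>n\<^sup>)\<close>, modulo null vectors, for the semi-inner product
  \<open>\<langle>h, k\<rangle> - \<langle>A h, A k\<rangle>\<close> (\<open>defect\<close>), the defect operator being the quotient map. This form requires
  no square root and no adjoint: one first builds the dilation on the purely algebraic space of
  finitely supported vectors of \<open>H \<oplus> (F \<otimes> H\<^sup>(\<^sup>n\<^sup>))\<close>, which is only a semi-inner product space, and
  completes once, at the end. An element of the algebraic space is a finitely supported
  function \<open>x\<close> from words to \<open>H\<close>: the value at the empty word is the component in \<open>H\<close>, and the value at
  \<open>w @ [j]\<close> is the \<open>j\<close>-th entry of the component at \<open>e\<^sub>w\<close>. In these coordinates \<open>S\<^sub>i\<close> moves the
  value at \<open>v\<close> to \<open>i # v\<close> and puts \<open>A\<^sub>i (x [])\<close> at the empty word (\<open>creation\<close>). The choice of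
  the semi-inner product makes the row of these shifts isometric (\<open>row_creation_isometric\<close>).

  Covariance forces the representation: it acts at the word \<open>v\<close> by \<open>\<pi>\<close> of the pullback of \<open>f\<close> along
  \<open>v\<close> (\<open>fock_rep\<close>). The covariance of \<open>\<pi>\<close> and \<open>A\<close> makes this a \<open>*\<close>-homomorphism for the
  semi-inner product, as it says that \<open>A\<close> intertwines \<open>f \<mapsto> \<Oplus>\<^sub>j \<pi> (f \<circ> \<sigma>\<^sub>j)\<close> with \<open>\<pi>\<close>
  (\<open>defect_star\<close>). Boundedness is then automatic, because a \<open>*\<close>-homomorphism of \<open>C0 X\<close> into the linear
  maps of a semi-inner product space is contractive (\<open>star_homomorphism_contractive\<close>). All operators
  therefore extend to the completion, where the relations persist by continuity. The complement of
  \<open>H\<close> in the completion consists of the limits of sequences whose components in \<open>H\<close> tend to \<open>0\<close>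
  (\<open>vacuum_null\<close>), and this property is preserved by each \<open>S\<^sub>i\<close>.
\<close>

section \<open>Semi-inner product spaces\<close>

locale semi_inner_product_space =
  fixes H :: "'a::ab_group_add hilbert"
  assumes vector_space: "vector_space (scl H)"
    and subspace: "module.subspace (scl H) (vecs H)"
    and ip_add: "\<lbrakk>x \<in> vecs H; y \<in> vecs H; z \<in> vecs H\<rbrakk> \<Longrightarrow> ip H (x + y) z = ip H x z + ip H y z"
    and ip_scl: "\<lbrakk>x \<in> vecs H; y \<in> vecs H\<rbrakk> \<Longrightarrow> ip H (scl H c x) y = c * ip H x y"
    and ip_cnj: "\<lbrakk>x \<in> vecs H; y \<in> vecs H\<rbrakk> \<Longrightarrow> ip H y x = cnj (ip H x y)"
    and ip_nonneg: "x \<in> vecs H \<Longrightarrow> 0 \<le> Re (ip H x x)"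
begin

sublocale vs: vector_space "scl H"
  by (rule vector_space)

lemmas zero_mem [simp, intro] = vs.subspace_0 [OF subspace]
lemmas add_mem [simp, intro] = vs.subspace_add [OF subspace]
lemmas diff_mem [simp, intro] = vs.subspace_diff [OF subspace]
lemmas scl_mem [simp, intro] = vs.subspace_scale [OF subspace]
lemmas sum_mem = vs.subspace_sum [OF subspace]

lemma ip_add_right:
  assumes "x \<in> vecs H" "y \<in> vecs H" "z \<in> vecs H"
  shows "ip H z (x + y) = ip H z x + ip H z y"
  using assms by (simp add: ip_cnj [of _ z] ip_add)

lemma ip_scl_right:
  assumes "x \<in> vecs H" "y \<in> vecs H"
  shows "ip H x (scl H c y) = cnj c * ip H x y"
  using assms by (simp add: ip_cnj [of _ x] ip_scl)

lemma ip_diff: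
  assumes "x \<in> vecs H" "y \<in> vecs H" "z \<in> vecs H"
  shows "ip H (x - y) z = ip H x z - ip H y z"
  using ip_add [of "x - y" y z] assms by (simp add: algebra_simps)

lemma ip_diff_right:
  assumes "x \<in> vecs H" "y \<in> vecs H" "z \<in> vecs H"
  shows "ip H z (x - y) = ip H z x - ip H z y"
  using assms by (simp add: ip_cnj [of _ z] ip_diff)

lemma ip_zero [simp]: "x \<in> vecs H \<Longrightarrow> ip H 0 x = 0"
  using ip_scl [of 0 x 0] by simp

lemma ip_zero_right [simp]: "x \<in> vecs H \<Longrightarrow> ip H x 0 = 0"
  using ip_cnj [of 0 x] by simp

lemma hnorm_nonneg [simp]: "x \<in> vecs H \<Longrightarrow> 0 \<le> hnorm H x"
  by (simp add: hnorm_def ip_nonneg)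

lemma hnorm_zero [simp]: "hnorm H 0 = 0"
  by (simp add: hnorm_def)

lemma hnorm_sq: "x \<in> vecs H \<Longrightarrow> (hnorm H x)\<^sup>2 = Re (ip H x x)"
  by (simp add: hnorm_def ip_nonneg)

lemma ip_self: "x \<in> vecs H \<Longrightarrow> ip H x x = complex_of_real ((hnorm H x)\<^sup>2)"
  using ip_cnj [of x x] by (simp add: hnorm_sq complex_eq_iff)

lemma hnorm_add_sq:
  assumes "x \<in> vecs H" "y \<in> vecs H"
  shows "(hnorm H (x + y))\<^sup>2 = (hnorm H x)\<^sup>2 + 2 * Re (ip H x y) + (hnorm H y)\<^sup>2"
  using assms ip_cnj [of x y] by (simp add: hnorm_sq ip_add ip_add_right)

lemma hnorm_diff_sq:
  assumes "x \<in> vecs H" "y \<in> vecs H"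
  shows "(hnorm H (x - y))\<^sup>2 = (hnorm H x)\<^sup>2 - 2 * Re (ip H x y) + (hnorm H y)\<^sup>2"
  using assms ip_cnj [of x y] by (simp add: hnorm_sq ip_diff ip_diff_right)

lemma hnorm_scl:
  assumes "x \<in> vecs H"
  shows "hnorm H (scl H c x) = cmod c * hnorm H x"
proof -
  have "ip H (scl H c x) (scl H c x) = c * cnj c * ip H x x"
    using assms by (simp add: ip_scl ip_scl_right)
  also have "\<dots> = complex_of_real ((cmod c * hnorm H x)\<^sup>2)"
    using assms by (simp add: complex_norm_square [symmetric] ip_self power_mult_distrib)
  finally have "(hnorm H (scl H c x))\<^sup>2 = (cmod c * hnorm H x)\<^sup>2"
    using assms by (simp add: hnorm_sq flip: of_real_power)
  then show ?thesis
    using assms by simp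
qed

lemma hnorm_minus_commute:
  assumes "x \<in> vecs H" "y \<in> vecs H"
  shows "hnorm H (x - y) = hnorm H (y - x)"
  using hnorm_scl [of "y - x" "-1"] assms by simp

lemma cauchy_schwarz:
  assumes x: "x \<in> vecs H" and y: "y \<in> vecs H"
  shows "cmod (ip H x y) \<le> hnorm H x * hnorm H y"
proof -
  \<comment> \<open>The squared norm of \<open>x - t c y\<close> is a nonnegative quadratic polynomial in the real variable \<open>t\<close>.
    When \<open>y\<close> is a null vector it is affine, which forces \<open>c = 0\<close>.\<close>
  define a b c where "a = (hnorm H y)\<^sup>2" and "b = (hnorm H x)\<^sup>2" and "c = ip H x y"
  have expand: "0 \<le> b - 2 * t * (cmod c)\<^sup>2 + t\<^sup>2 * (cmod c)\<^sup>2 * a" for t :: real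
  proof -
    have cc: "cnj c * c = complex_of_real ((cmod c)\<^sup>2)"
      by (simp only: complex_norm_square mult.commute)
    have "(hnorm H (x - scl H (of_real t * c) y))\<^sup>2
        = b - 2 * Re (of_real t * (cnj c * c)) + (cmod (of_real t * c) * hnorm H y)\<^sup>2"
      using x y by (simp add: hnorm_diff_sq hnorm_scl ip_scl_right b_def c_def mult.assoc)
    then have "b - 2 * t * (cmod c)\<^sup>2 + t\<^sup>2 * (cmod c)\<^sup>2 * a = (hnorm H (x - scl H (of_real t * c) y))\<^sup>2"
      unfolding cc by (simp add: norm_mult power_mult_distrib a_def)
    then show ?thesis by simp
  qed
  have "(cmod c)\<^sup>2 \<le> b * a"
  proof (cases "a = 0")
    case True
    have "c = 0"
    proof (rule ccontr)
      assume "c \<noteq> 0"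
      with True expand [of "(b + 1) / (2 * (cmod c)\<^sup>2)"] show False by simp
    qed
    with True show ?thesis by simp
  next
    case False
    then have "a > 0" by (simp add: a_def)
    with expand [of "1 / a"] show ?thesis
      by (simp add: field_simps power2_eq_square)
  qed
  then have "(cmod c)\<^sup>2 \<le> (hnorm H x * hnorm H y)\<^sup>2"
    by (simp add: a_def b_def power_mult_distrib)
  then show ?thesis
    using x y by (simp add: c_def)
qed

lemma hnorm_triangle:
  assumes x: "x \<in> vecs H" and y: "y \<in> vecs H"
  shows "hnorm H (x + y) \<le> hnorm H x + hnorm H y"
proof (rule power2_le_imp_le)
  show "(hnorm H (x + y))\<^sup>2 \<le> (hnorm H x + hnorm H y)\<^sup>2"
    using cauchy_schwarz [OF x y] complex_Re_le_cmod [of "ip H x y"] x y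
    by (simp add: hnorm_add_sq power2_sum)
qed (use x y in simp)

lemma hnorm_diff_triangle:
  assumes "x \<in> vecs H" "y \<in> vecs H" "z \<in> vecs H"
  shows "hnorm H (x - z) \<le> hnorm H (x - y) + hnorm H (y - z)"
  using hnorm_triangle [of "x - y" "y - z"] assms by simp

lemma abs_hnorm_diff_le:
  assumes "x \<in> vecs H" "y \<in> vecs H"
  shows "\<bar>hnorm H x - hnorm H y\<bar> \<le> hnorm H (x - y)"
  using hnorm_diff_triangle [of x y 0] hnorm_diff_triangle [of y x 0]
    hnorm_minus_commute [of x y] assms by simp

lemma bounded_operatorI:
  assumes "\<And>x. x \<in> vecs H \<Longrightarrow> T x \<in> vecs H"
    and "\<And>x y. \<lbrakk>x \<in> vecs H; y \<in> vecs H\<rbrakk> \<Longrightarrow> T (x + y) = T x + T y"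
    and "\<And>c x. x \<in> vecs H \<Longrightarrow> T (scl H c x) = scl H c (T x)"
    and "\<And>x. x \<in> vecs H \<Longrightarrow> hnorm H (T x) \<le> B * hnorm H x"
  shows "bounded_operator H T"
  unfolding bounded_operator_def linear_between_def by (intro conjI ballI allI exI [of _ B] Pi_I assms)

lemma
  assumes "bounded_operator H T" "x \<in> vecs H"
  shows bounded_operator_mem: "T x \<in> vecs H"
    and bounded_operator_scl: "T (scl H c x) = scl H c (T x)"
    and bounded_operator_add: "y \<in> vecs H \<Longrightarrow> T (x + y) = T x + T y"
  using assms unfolding bounded_operator_def linear_between_def by blast+

lemma bounded_operator_diff:
  assumes "bounded_operator H T" "x \<in> vecs H" "y \<in> vecs H"
  shows "T (x - y) = T x - T y"
  using bounded_operator_add [OF assms(1), of "x - y" y] assms by (simp add: algebra_simps)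

lemma bounded_operator_zero: "bounded_operator H T \<Longrightarrow> T 0 = 0"
  using bounded_operator_scl [of T 0 0] by simp

lemma bounded_operator_bound:
  assumes "bounded_operator H T"
  shows "\<exists>B>0. \<forall>x\<in>vecs H. hnorm H (T x) \<le> B * hnorm H x"
proof -
  from assms obtain B where B: "\<And>x. x \<in> vecs H \<Longrightarrow> hnorm H (T x) \<le> B * hnorm H x"
    unfolding bounded_operator_def by blast
  have "hnorm H (T x) \<le> (\<bar>B\<bar> + 1) * hnorm H x" if "x \<in> vecs H" for x
  proof -
    have "B * hnorm H x \<le> (\<bar>B\<bar> + 1) * hnorm H x"
      using that by (intro mult_right_mono) auto
    with B [OF that] show ?thesis by linarith
  qed
  then show ?thesis
    by (intro exI [of _ "\<bar>B\<bar> + 1"]) auto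
qed

end

sublocale complex_hilbert_space \<subseteq> semi_inner_product_space H
  by (rule semi_inner_product_space.intro) (fact vector_space subspace ip_add ip_scl ip_cnj ip_nonneg)+

section \<open>Cauchy sequences\<close>

context semi_inner_product_space
begin

definition cauchy_seq :: "(nat \<Rightarrow> 'a) \<Rightarrow> bool" where
  "cauchy_seq s \<longleftrightarrow> (\<forall>k. s k \<in> vecs H) \<and>
     (\<forall>e>0. \<exists>N. \<forall>m\<ge>N. \<forall>k\<ge>N. hnorm H (s m - s k) < e)"

definition null_seq :: "(nat \<Rightarrow> 'a) \<Rightarrow> bool" where
  "null_seq s \<longleftrightarrow> (\<forall>k. s k \<in> vecs H) \<and> (\<lambda>k. hnorm H (s k)) \<longlonglongrightarrow> 0"

lemma cauchy_seq_mem: "cauchy_seq s \<Longrightarrow> s k \<in> vecs H"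
  by (simp add: cauchy_seq_def)

lemma null_seq_mem: "null_seq s \<Longrightarrow> s k \<in> vecs H"
  by (simp add: null_seq_def)

lemma null_seqI:
  assumes "\<And>k. s k \<in> vecs H" and "\<And>k. hnorm H (s k) \<le> u k" and "u \<longlonglongrightarrow> 0"
  shows "null_seq s"
  unfolding null_seq_def
  by (intro conjI allI assms(1) Lim_null_comparison [OF always_eventually assms(3)])
    (simp add: assms(1,2))

lemma cauchy_seqI:
  assumes "\<And>k. s k \<in> vecs H" and "\<And>m k. hnorm H (s m - s k) \<le> u m k"
    and "\<And>e. 0 < e \<Longrightarrow> \<exists>N. \<forall>m\<ge>N. \<forall>k\<ge>N. u m k < e"
  shows "cauchy_seq s"
  unfolding cauchy_seq_def using assms by (meson le_less_trans)

lemma cauchy_seq_const: "x \<in> vecs H \<Longrightarrow> cauchy_seq (\<lambda>k. x)"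
  by (simp add: cauchy_seq_def)

lemma cauchy_seq_bounded_operator:
  assumes "bounded_operator H T" "cauchy_seq s"
  shows "cauchy_seq (\<lambda>k. T (s k))"
proof -
  obtain B where B: "0 < B" "\<And>x. x \<in> vecs H \<Longrightarrow> hnorm H (T x) \<le> B * hnorm H x"
    using bounded_operator_bound [OF assms(1)] by blast
  show ?thesis
  proof (rule cauchy_seqI)
    show "hnorm H (T (s m) - T (s k)) \<le> B * hnorm H (s m - s k)" for m k
      using B(2) [of "s m - s k"] assms
      by (simp add: cauchy_seq_mem bounded_operator_diff)
    show "\<exists>N. \<forall>m\<ge>N. \<forall>k\<ge>N. B * hnorm H (s m - s k) < e" if "0 < e" for e
    proof -
      from that B have "0 < e / B" by simp
      then obtain N where "\<forall>m\<ge>N. \<forall>k\<ge>N. hnorm H (s m - s k) < e / B"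
        using assms(2) unfolding cauchy_seq_def by blast
      then show ?thesis
        using B by (auto simp: field_simps)
    qed
  qed (use assms in \<open>simp add: cauchy_seq_mem bounded_operator_mem\<close>)
qed

lemma null_seq_bounded_operator:
  assumes "bounded_operator H T" "null_seq s"
  shows "null_seq (\<lambda>k. T (s k))"
proof -
  obtain B where B: "0 < B" "\<And>x. x \<in> vecs H \<Longrightarrow> hnorm H (T x) \<le> B * hnorm H x"
    using bounded_operator_bound [OF assms(1)] by blast
  show ?thesis
  proof (rule null_seqI)
    show "(\<lambda>k. B * hnorm H (s k)) \<longlonglongrightarrow> 0"
      using assms(2) by (auto simp: null_seq_def intro: tendsto_mult_right_zero)
  qed (use assms B in \<open>simp_all add: null_seq_mem bounded_operator_mem\<close>)
qed

lemma bounded_operator_scalar: "bounded_operator H (scl H c)"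
  by (rule bounded_operatorI [where B = "cmod c"])
    (simp_all add: hnorm_scl vs.scale_right_distrib mult.commute)

lemma cauchy_seq_add:
  assumes s: "cauchy_seq s" and t: "cauchy_seq t"
  shows "cauchy_seq (\<lambda>k. s k + t k)"
proof (rule cauchy_seqI)
  fix m k
  have eq: "s m + t m - (s k + t k) = (s m - s k) + (t m - t k)" by simp
  show "hnorm H (s m + t m - (s k + t k)) \<le> hnorm H (s m - s k) + hnorm H (t m - t k)"
    unfolding eq by (intro hnorm_triangle diff_mem cauchy_seq_mem s t)
next
  fix e :: real
  assume "0 < e"
  then have "0 < e / 2" by simp
  then obtain M N where "\<forall>m\<ge>M. \<forall>k\<ge>M. hnorm H (s m - s k) < e / 2"
    and "\<forall>m\<ge>N. \<forall>k\<ge>N. hnorm H (t m - t k) < e / 2"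
    using s t unfolding cauchy_seq_def by blast
  then have "\<forall>m\<ge>max M N. \<forall>k\<ge>max M N. hnorm H (s m - s k) + hnorm H (t m - t k) < e"
    by (smt (verit) field_sum_of_halves max.bounded_iff)
  then show "\<exists>N. \<forall>m\<ge>N. \<forall>k\<ge>N. hnorm H (s m - s k) + hnorm H (t m - t k) < e" by blast
qed (use s t in \<open>simp add: cauchy_seq_mem\<close>)

lemma null_seq_add:
  assumes s: "null_seq s" and t: "null_seq t"
  shows "null_seq (\<lambda>k. s k + t k)"
proof (rule null_seqI)
  show "(\<lambda>k. hnorm H (s k) + hnorm H (t k)) \<longlonglongrightarrow> 0"
    using s t by (auto simp: null_seq_def intro: tendsto_add_zero)
qed (use s t in \<open>simp_all add: null_seq_mem hnorm_triangle\<close>)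

lemma null_imp_cauchy_seq:
  assumes s: "null_seq s"
  shows "cauchy_seq s"
proof (rule cauchy_seqI)
  fix m k
  show "hnorm H (s m - s k) \<le> hnorm H (s m) + hnorm H (s k)"
    using hnorm_diff_triangle [of "s m" 0 "s k"] hnorm_minus_commute [of 0 "s k"] s
    by (simp add: null_seq_mem)
next
  fix e :: real
  assume "0 < e"
  then have "0 < e / 2" by simp
  then have "\<forall>\<^sub>F k in sequentially. hnorm H (s k) < e / 2"
    using s unfolding null_seq_def by (intro order_tendstoD(2)) auto
  then obtain N where N: "\<And>k. N \<le> k \<Longrightarrow> hnorm H (s k) < e / 2"
    unfolding eventually_sequentially by blast
  have "hnorm H (s m) + hnorm H (s k) < e" if "N \<le> m" "N \<le> k" for m k
    using N [OF that(1)] N [OF that(2)] by linarith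
  then show "\<exists>N. \<forall>m\<ge>N. \<forall>k\<ge>N. hnorm H (s m) + hnorm H (s k) < e" by blast
qed (use s in \<open>simp add: null_seq_mem\<close>)

lemma convergent_hnorm:
  assumes s: "cauchy_seq s"
  shows "convergent (\<lambda>k. hnorm H (s k))"
proof (rule real_Cauchy_convergent, rule metric_CauchyI)
  fix e :: real
  assume "0 < e"
  with s obtain N where "\<forall>m\<ge>N. \<forall>k\<ge>N. hnorm H (s m - s k) < e"
    unfolding cauchy_seq_def by blast
  moreover have "dist (hnorm H (s m)) (hnorm H (s k)) \<le> hnorm H (s m - s k)" for m k
    using abs_hnorm_diff_le [of "s m" "s k"] s by (simp add: dist_real_def cauchy_seq_mem)
  ultimately show "\<exists>M. \<forall>m\<ge>M. \<forall>n\<ge>M. dist (hnorm H (s m)) (hnorm H (s n)) < e"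
    by (meson le_less_trans)
qed

text \<open>
  By polarization, real parts of inner products are combinations of squared norms, and norms of
  Cauchy sequences converge.
\<close>

lemma convergent_ip:
  assumes s: "cauchy_seq s" and t: "cauchy_seq t"
  shows "convergent (\<lambda>k. ip H (s k) (t k))"
proof -
  have Re: "convergent (\<lambda>k. Re (ip H (s k) (u k)))" if u: "cauchy_seq u" for u
  proof -
    have "(\<lambda>k. Re (ip H (s k) (u k)))
        = (\<lambda>k. ((hnorm H (s k + u k))\<^sup>2 - (hnorm H (s k))\<^sup>2 - (hnorm H (u k))\<^sup>2) / 2)"
      using s u by (simp add: hnorm_add_sq cauchy_seq_mem)
    moreover have "convergent (\<lambda>k. ((hnorm H (s k + u k))\<^sup>2 - (hnorm H (s k))\<^sup>2 - (hnorm H (u k))\<^sup>2) / 2)"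
    proof -
      obtain a b c where "(\<lambda>k. hnorm H (s k + u k)) \<longlonglongrightarrow> a" "(\<lambda>k. hnorm H (s k)) \<longlonglongrightarrow> b"
        "(\<lambda>k. hnorm H (u k)) \<longlonglongrightarrow> c"
        using convergent_hnorm [OF cauchy_seq_add [OF s u]] convergent_hnorm [OF s] convergent_hnorm [OF u]
        unfolding convergent_def by blast
      then have "(\<lambda>k. ((hnorm H (s k + u k))\<^sup>2 - (hnorm H (s k))\<^sup>2 - (hnorm H (u k))\<^sup>2) / 2)
          \<longlonglongrightarrow> (a\<^sup>2 - b\<^sup>2 - c\<^sup>2) / 2"
        by (intro tendsto_intros) auto
      then show ?thesis by (rule convergentI)
    qed
    ultimately show ?thesis by simp
  qed
  have "(\<lambda>k. Im (ip H (s k) (t k))) = (\<lambda>k. Re (ip H (s k) (scl H \<i> (t k))))"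
    using s t by (simp add: ip_scl_right cauchy_seq_mem)
  then have "convergent (\<lambda>k. Im (ip H (s k) (t k)))"
    using Re [OF cauchy_seq_bounded_operator [OF bounded_operator_scalar [of \<i>] t]] by simp
  with Re [OF t] obtain a b where "(\<lambda>k. Re (ip H (s k) (t k))) \<longlonglongrightarrow> a" "(\<lambda>k. Im (ip H (s k) (t k))) \<longlonglongrightarrow> b"
    unfolding convergent_def by blast
  from tendsto_Complex [OF this] show ?thesis
    by (intro convergentI) simp
qed

lemma null_seq_ip:
  assumes s: "null_seq s" and t: "cauchy_seq t"
  shows "(\<lambda>k. ip H (s k) (t k)) \<longlonglongrightarrow> 0" and "(\<lambda>k. ip H (t k) (s k)) \<longlonglongrightarrow> 0"
proof -
  obtain L where "(\<lambda>k. hnorm H (t k)) \<longlonglongrightarrow> L"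
    using convergent_hnorm [OF t] unfolding convergent_def by blast
  with s have "(\<lambda>k. hnorm H (s k) * hnorm H (t k)) \<longlonglongrightarrow> 0 * L"
    unfolding null_seq_def by (intro tendsto_mult) auto
  then have lim: "(\<lambda>k. hnorm H (s k) * hnorm H (t k)) \<longlonglongrightarrow> 0" by simp
  show "(\<lambda>k. ip H (s k) (t k)) \<longlonglongrightarrow> 0"
    by (rule Lim_null_comparison [OF always_eventually lim])
      (use s t in \<open>simp add: cauchy_schwarz null_seq_mem cauchy_seq_mem\<close>)
  show "(\<lambda>k. ip H (t k) (s k)) \<longlonglongrightarrow> 0"
    by (rule Lim_null_comparison [OF always_eventually lim])
      (use s t cauchy_schwarz [of "t _" "s _"] in
        \<open>simp add: null_seq_mem cauchy_seq_mem mult.commute\<close>)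
qed

end

section \<open>Completion of a semi-inner product space\<close>

text \<open>
  The completion is the space of Cauchy sequences modulo null sequences. A quotient would be a new
  type; instead each class is represented by one of its members. A linear projection of the type of
  all sequences onto the null sequences exists by the choice of a basis, and its kernel meets every class
  of Cauchy sequences in exactly one point. The completion is the set of these points, a linear
  subspace of the type of sequences.

  Sequences are coded by elements of a type \<open>'b\<close> through \<open>coord\<close> and \<open>tuple\<close>. This makes it possible
  to realize the completion inside a prescribed type, provided that the coding is additive.
\<close>

locale completion = semi_inner_product_space H for H :: "'a::ab_group_add hilbert" +
  fixes coord :: "'b::ab_group_add \<Rightarrow> nat \<Rightarrow> 'a" and tuple :: "(nat \<Rightarrow> 'a) \<Rightarrow> 'b"
  assumes coord_tuple [simp]: "coord (tuple s) = s"
    and tuple_coord [simp]: "tuple (coord b) = b"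
    and coord_add: "coord (b + c) k = coord b k + coord c k"
begin

definition scale_seq :: "complex \<Rightarrow> 'b \<Rightarrow> 'b" where
  "scale_seq c b = tuple (\<lambda>k. scl H c (coord b k))"

lemma coord_eqI: "(\<And>k. coord b k = coord c k) \<Longrightarrow> b = c"
  by (metis ext tuple_coord)

lemma coord_zero [simp]: "coord 0 k = 0"
  using coord_add [of 0 0 k] by simp

lemma coord_diff: "coord (b - c) k = coord b k - coord c k"
  using coord_add [of "b - c" c k] by simp

lemma coord_scale_seq [simp]: "coord (scale_seq c b) k = scl H c (coord b k)"
  by (simp add: scale_seq_def)

sublocale seqs: vector_space scale_seq
  by unfold_locales
    (auto intro!: coord_eqI simp: coord_add vs.scale_right_distrib vs.scale_left_distrib)

lemma tuple_add: "tuple (\<lambda>k. s k + t k) = tuple s + tuple t"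
  by (rule coord_eqI) (simp add: coord_add)

lemma tuple_diff: "tuple (\<lambda>k. s k - t k) = tuple s - tuple t"
  by (rule coord_eqI) (simp add: coord_diff)

lemma tuple_scale: "tuple (\<lambda>k. scl H c (s k)) = scale_seq c (tuple s)"
  by (rule coord_eqI) simp

lemma ex_null_projection:
  "\<exists>g. Vector_Spaces.linear scale_seq scale_seq g \<and> (\<forall>b. null_seq (coord (g b))) \<and>
       (\<forall>b. null_seq (coord b) \<longrightarrow> g b = b)"
proof -
  interpret vector_space_pair scale_seq scale_seq ..
  define N where "N = {b. null_seq (coord b)}"
  have "seqs.subspace N"
  proof (rule seqs.subspaceI)
    show "0 \<in> N"
      by (simp add: N_def null_seq_def)
    show "b + c \<in> N" if "b \<in> N" "c \<in> N" for b c
    proof -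
      have "coord (b + c) = (\<lambda>k. coord b k + coord c k)"
        by (rule ext) (rule coord_add)
      with that null_seq_add show ?thesis
        by (simp add: N_def)
    qed
    show "scale_seq a b \<in> N" if "b \<in> N" for a b
    proof -
      have "coord (scale_seq a b) = (\<lambda>k. scl H a (coord b k))"
        by (rule ext) simp
      with that null_seq_bounded_operator [OF bounded_operator_scalar] show ?thesis
        by (simp add: N_def)
    qed
  qed
  then have "\<exists>g. range g \<subseteq> N \<and> Vector_Spaces.linear scale_seq scale_seq g \<and> (\<forall>v\<in>N. g (id v) = v)"
    by (intro linear_exists_left_inverse_on) (auto simp: seqs.linear_ident)
  then show ?thesis
    by (auto simp: N_def)
qed

definition null_projection :: "'b \<Rightarrow> 'b" where
  "null_projection = (SOME g. Vector_Spaces.linear scale_seq scale_seq g \<and> (\<forall>b. null_seq (coord (g b))) \<and>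
       (\<forall>b. null_seq (coord b) \<longrightarrow> g b = b))"

lemma
  shows linear_null_projection: "Vector_Spaces.linear scale_seq scale_seq null_projection"
    and null_seq_null_projection: "null_seq (coord (null_projection b))"
    and null_projection_null: "null_seq (coord b) \<Longrightarrow> null_projection b = b"
  using someI_ex [OF ex_null_projection] unfolding null_projection_def by blast+

sublocale np: Vector_Spaces.linear scale_seq scale_seq null_projection
  by (rule linear_null_projection)

text \<open>
  The representative of the class of \<open>s\<close>.
\<close>

definition cls :: "(nat \<Rightarrow> 'a) \<Rightarrow> 'b" where
  "cls s = tuple s - null_projection (tuple s)"

lemma cls_add: "cls (\<lambda>k. s k + t k) = cls s + cls t"
  by (simp add: cls_def tuple_add np.add)

lemma cls_diff: "cls (\<lambda>k. s k - t k) = cls s - cls t"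
  by (simp add: cls_def tuple_diff np.diff)

lemma cls_scl: "cls (\<lambda>k. scl H c (s k)) = scale_seq c (cls s)"
  by (simp add: cls_def tuple_scale np.scale seqs.scale_right_diff_distrib)

lemma cls_null: "null_seq s \<Longrightarrow> cls s = 0"
  by (simp add: cls_def null_projection_null)

lemma cls_zero [simp]: "cls (\<lambda>k. 0) = 0"
  by (rule cls_null) (simp add: null_seq_def)

lemma cls_sum: "cls (\<lambda>k. \<Sum>i\<in>I. s i k) = (\<Sum>i\<in>I. cls (s i))"
  by (induction I rule: infinite_finite_induct) (simp_all add: cls_add)

lemma null_seq_coord_cls: "null_seq (\<lambda>k. s k - coord (cls s) k)"
  using null_seq_null_projection [of "tuple s"] by (simp add: cls_def coord_diff)

lemma cauchy_seq_coord_cls: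
  assumes "cauchy_seq s"
  shows "cauchy_seq (coord (cls s))"
proof -
  have "null_seq (\<lambda>k. scl H (-1) (s k - coord (cls s) k))"
    by (rule null_seq_bounded_operator [OF bounded_operator_scalar null_seq_coord_cls])
  from cauchy_seq_add [OF assms null_imp_cauchy_seq [OF this]] show ?thesis
    by simp
qed

lemma cls_coord_cls: "cls (coord (cls s)) = cls s"
  using cls_null [OF null_seq_coord_cls, of s] cls_diff [of s "coord (cls s)"] by simp

text \<open>
  The inner product is cut off outside the carrier, because the library notion of a metric asks for
  symmetry and nonnegativity on the whole type.
\<close>

definition cmpl :: "'b hilbert" where
  "cmpl = \<lparr>vecs = cls ` Collect cauchy_seq, scl = scale_seq,
     ip = (\<lambda>x y. if x \<in> cls ` Collect cauchy_seq \<and> y \<in> cls ` Collect cauchy_seq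
        then lim (\<lambda>k. ip H (coord x k) (coord y k)) else 0)\<rparr>"

lemma scl_cmpl [simp]: "scl cmpl = scale_seq"
  by (simp add: cmpl_def)

lemma cls_mem: "cauchy_seq s \<Longrightarrow> cls s \<in> vecs cmpl"
  by (simp add: cmpl_def)

text \<open>
  Elements of the completion are treated as classes of Cauchy sequences; with \<open>ip_cls\<close> and
  \<open>extension_cls\<close> below, every identity in the completion reduces to a limit or to a pointwise
  identity.
\<close>

lemma cmpl_cases:
  assumes "x \<in> vecs cmpl"
  obtains s where "cauchy_seq s" "x = cls s" "coord x = s"
proof -
  from assms obtain t where t: "cauchy_seq t" "x = cls t"
    by (auto simp: cmpl_def)
  show ?thesis
  proof
    show "cauchy_seq (coord x)"
      using t by (simp add: cauchy_seq_coord_cls)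
    show "x = cls (coord x)"
      using t by (simp add: cls_coord_cls)
  qed simp
qed

lemma ip_cls:
  assumes s: "cauchy_seq s" and t: "cauchy_seq t"
  shows "(\<lambda>k. ip H (s k) (t k)) \<longlonglongrightarrow> ip cmpl (cls s) (cls t)"
proof -
  let ?s = "coord (cls s)" and ?t = "coord (cls t)"
  have cs: "cauchy_seq ?s" and ct: "cauchy_seq ?t"
    using s t by (simp_all add: cauchy_seq_coord_cls)
  have "(\<lambda>k. ip H (?s k) (?t k)) \<longlonglongrightarrow> ip cmpl (cls s) (cls t)"
    using convergent_ip [OF cs ct] s t by (simp add: cmpl_def convergent_LIMSEQ_iff)
  moreover have "(\<lambda>k. ip H (s k - ?s k) (t k) + ip H (?s k) (t k - ?t k)) \<longlonglongrightarrow> 0"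
    using null_seq_ip(1) [OF null_seq_coord_cls t, of s] null_seq_ip(2) [OF null_seq_coord_cls cs, of t]
    by (rule tendsto_add_zero)
  ultimately have "(\<lambda>k. ip H (?s k) (?t k) + (ip H (s k - ?s k) (t k) + ip H (?s k) (t k - ?t k)))
      \<longlonglongrightarrow> ip cmpl (cls s) (cls t)"
    using tendsto_add by fastforce
  then show ?thesis
    using s t cs ct by (simp add: ip_diff ip_diff_right cauchy_seq_mem)
qed

lemma ip_cls_eq:
  assumes "cauchy_seq s" "cauchy_seq t" and "(\<lambda>k. ip H (s k) (t k)) \<longlonglongrightarrow> l"
  shows "ip cmpl (cls s) (cls t) = l"
  using ip_cls [OF assms(1,2)] assms(3) LIMSEQ_unique by blast

lemma hnorm_cls:
  assumes s: "cauchy_seq s"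
  shows "(\<lambda>k. hnorm H (s k)) \<longlonglongrightarrow> hnorm cmpl (cls s)"
  unfolding hnorm_def by (intro tendsto_intros ip_cls s)

sublocale cmpl: semi_inner_product_space cmpl
proof (rule semi_inner_product_space.intro)
  show "vector_space (scl cmpl)"
    by simp (rule seqs.vector_space_axioms)
  show "module.subspace (scl cmpl) (vecs cmpl)"
    unfolding scl_cmpl
  proof (rule seqs.subspaceI)
    show "0 \<in> vecs cmpl"
      using cls_mem [OF cauchy_seq_const [OF zero_mem]] by simp
    show "x + y \<in> vecs cmpl" if "x \<in> vecs cmpl" "y \<in> vecs cmpl" for x y
      using that by (elim cmpl_cases) (metis cls_add cls_mem cauchy_seq_add)
    show "scale_seq c x \<in> vecs cmpl" if "x \<in> vecs cmpl" for c x
      using that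
      by (elim cmpl_cases) (metis cls_scl cls_mem cauchy_seq_bounded_operator bounded_operator_scalar)
  qed
next
  fix x y z
  assume "x \<in> vecs cmpl" "y \<in> vecs cmpl" "z \<in> vecs cmpl"
  then obtain s t u where s: "cauchy_seq s" "x = cls s" and t: "cauchy_seq t" "y = cls t"
    and u: "cauchy_seq u" "z = cls u"
    by (meson cmpl_cases)
  have "ip cmpl (cls (\<lambda>k. s k + t k)) (cls u) = ip cmpl (cls s) (cls u) + ip cmpl (cls t) (cls u)"
  proof (rule ip_cls_eq)
    show "(\<lambda>k. ip H (s k + t k) (u k)) \<longlonglongrightarrow> ip cmpl (cls s) (cls u) + ip cmpl (cls t) (cls u)"
      using tendsto_add [OF ip_cls [OF s(1) u(1)] ip_cls [OF t(1) u(1)]] s t u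
      by (simp add: ip_add cauchy_seq_mem)
  qed (use s t u in \<open>simp_all add: cauchy_seq_add\<close>)
  then show "ip cmpl (x + y) z = ip cmpl x z + ip cmpl y z"
    by (simp add: cls_add s t u)
next
  fix x y c
  assume "x \<in> vecs cmpl" "y \<in> vecs cmpl"
  then obtain s t where s: "cauchy_seq s" "x = cls s" and t: "cauchy_seq t" "y = cls t"
    by (meson cmpl_cases)
  have "ip cmpl (cls (\<lambda>k. scl H c (s k))) (cls t) = c * ip cmpl (cls s) (cls t)"
  proof (rule ip_cls_eq)
    show "(\<lambda>k. ip H (scl H c (s k)) (t k)) \<longlonglongrightarrow> c * ip cmpl (cls s) (cls t)"
      using tendsto_mult_left [OF ip_cls [OF s(1) t(1)]] s t by (simp add: ip_scl cauchy_seq_mem)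
  qed (use s t in \<open>simp_all add: cauchy_seq_bounded_operator bounded_operator_scalar\<close>)
  then show "ip cmpl (scl cmpl c x) y = c * ip cmpl x y"
    by (simp add: cls_scl s t)
next
  fix x y
  assume "x \<in> vecs cmpl" "y \<in> vecs cmpl"
  then obtain s t where s: "cauchy_seq s" "x = cls s" and t: "cauchy_seq t" "y = cls t"
    by (meson cmpl_cases)
  have "(\<lambda>k. ip H (t k) (s k)) \<longlonglongrightarrow> cnj (ip cmpl (cls s) (cls t))"
    using tendsto_cnj [OF ip_cls [OF s(1) t(1)]] s t
    by (simp add: cauchy_seq_mem flip: ip_cnj)
  from ip_cls_eq [OF t(1) s(1) this] show "ip cmpl y x = cnj (ip cmpl x y)"
    by (simp add: s t)
next
  fix x
  assume "x \<in> vecs cmpl"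
  then obtain s where s: "cauchy_seq s" "x = cls s"
    by (meson cmpl_cases)
  show "0 \<le> Re (ip cmpl x x)"
    by (rule LIMSEQ_le_const [OF tendsto_Re [OF ip_cls [OF s(1) s(1), folded s(2)]]])
      (use s in \<open>simp add: ip_nonneg cauchy_seq_mem\<close>)
qed

lemma cmpl_definite:
  assumes "x \<in> vecs cmpl" "hnorm cmpl x = 0"
  shows "x = 0"
proof -
  from assms(1) obtain s where s: "cauchy_seq s" "x = cls s"
    by (meson cmpl_cases)
  then have "null_seq s"
    using hnorm_cls [OF s(1)] assms(2) by (simp add: null_seq_def cauchy_seq_mem)
  then show ?thesis
    by (simp add: s cls_null)
qed

definition incl :: "'a \<Rightarrow> 'b" where
  "incl a = cls (\<lambda>k. a)"

lemma incl_mem: "a \<in> vecs H \<Longrightarrow> incl a \<in> vecs cmpl"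
  unfolding incl_def by (intro cls_mem cauchy_seq_const)

lemma incl_diff: "incl (a - b) = incl a - incl b"
  unfolding incl_def by (rule cls_diff)

lemma ip_incl: "\<lbrakk>a \<in> vecs H; b \<in> vecs H\<rbrakk> \<Longrightarrow> ip cmpl (incl a) (incl b) = ip H a b"
  unfolding incl_def by (rule ip_cls_eq) (simp_all add: cauchy_seq_const)

lemma hnorm_incl: "a \<in> vecs H \<Longrightarrow> hnorm cmpl (incl a) = hnorm H a"
  by (simp add: hnorm_def ip_incl)

lemma incl_tendsto_cls:
  assumes s: "cauchy_seq s"
  shows "(\<lambda>m. hnorm cmpl (cls s - incl (s m))) \<longlonglongrightarrow> 0"
proof (rule LIMSEQ_I)
  fix e :: real
  assume "0 < e"
  then have "0 < e / 2" by simp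
  then obtain N where N: "\<forall>m\<ge>N. \<forall>k\<ge>N. hnorm H (s m - s k) < e / 2"
    using s unfolding cauchy_seq_def by blast
  have "hnorm cmpl (cls s - incl (s m)) < e" if "N \<le> m" for m
  proof -
    have const: "cauchy_seq (\<lambda>k. scl H (-1) (s m))"
      using s by (intro cauchy_seq_const scl_mem cauchy_seq_mem)
    have c: "cauchy_seq (\<lambda>k. s k - s m)"
      using cauchy_seq_add [OF s const] by simp
    have "hnorm cmpl (cls (\<lambda>k. s k - s m)) \<le> e / 2"
    proof (rule LIMSEQ_le_const2 [OF hnorm_cls [OF c]])
      show "\<exists>M. \<forall>k\<ge>M. hnorm H (s k - s m) \<le> e / 2"
        using N that by (meson less_imp_le)
    qed
    then show ?thesis
      using \<open>0 < e\<close> by (simp add: cls_diff incl_def)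
  qed
  then show "\<exists>N. \<forall>m\<ge>N. norm (hnorm cmpl (cls s - incl (s m)) - 0) < e"
    using s by (auto simp: cls_mem incl_mem cauchy_seq_mem)
qed

text \<open>
  Each \<open>x k\<close> is within \<open>1 / (k + 1)\<close> of a constant sequence \<open>a k\<close>. The sequence \<open>a\<close> is Cauchy
  in the original space, and its class is the limit.
\<close>

lemma cmpl_complete:
  assumes x: "\<And>k. x k \<in> vecs cmpl"
    and cauchy: "\<And>e. 0 < e \<Longrightarrow> \<exists>N. \<forall>m\<ge>N. \<forall>k\<ge>N. hnorm cmpl (x m - x k) < e"
  shows "\<exists>l\<in>vecs cmpl. (\<lambda>k. hnorm cmpl (x k - l)) \<longlonglongrightarrow> 0"
proof -
  have "\<exists>a\<in>vecs H. hnorm cmpl (x k - incl a) < inverse (Suc k)" for k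
  proof -
    obtain s where s: "cauchy_seq s" "x k = cls s"
      using x by (meson cmpl_cases)
    have "\<forall>\<^sub>F m in sequentially. hnorm cmpl (cls s - incl (s m)) < inverse (Suc k)"
      by (rule order_tendstoD [OF incl_tendsto_cls [OF s(1)]]) simp
    then show ?thesis
      using s by (auto simp: eventually_sequentially cauchy_seq_mem)
  qed
  then obtain a where a: "\<And>k. a k \<in> vecs H"
    and near: "\<And>k. hnorm cmpl (x k - incl (a k)) < inverse (Suc k)"
    by metis
  have inv: "(\<lambda>k. inverse (real (Suc k))) \<longlonglongrightarrow> 0"
    by (rule LIMSEQ_inverse_real_of_nat)
  have "cauchy_seq a"
  proof (rule cauchy_seqI [OF a])
    fix m k
    have "hnorm H (a m - a k) = hnorm cmpl (incl (a m) - incl (a k))"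
      using a by (simp add: hnorm_incl flip: incl_diff)
    also have "\<dots> \<le> hnorm cmpl (x m - incl (a m)) + hnorm cmpl (x m - x k) + hnorm cmpl (x k - incl (a k))"
      using cmpl.hnorm_diff_triangle [of "incl (a m)" "x m" "incl (a k)"]
        cmpl.hnorm_diff_triangle [of "x m" "x k" "incl (a k)"]
        cmpl.hnorm_minus_commute [of "incl (a m)" "x m"] x a
      by (simp add: incl_mem)
    also have "\<dots> \<le> inverse (Suc m) + hnorm cmpl (x m - x k) + inverse (Suc k)"
      using near [of m] near [of k] by linarith
    finally show "hnorm H (a m - a k) \<le> inverse (Suc m) + hnorm cmpl (x m - x k) + inverse (Suc k)" .
  next
    fix e :: real
    assume "0 < e"
    then have e: "0 < e / 3" by simp
    obtain M where M: "\<forall>m\<ge>M. \<forall>k\<ge>M. hnorm cmpl (x m - x k) < e / 3"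
      using cauchy [OF e] by blast
    obtain N where N: "\<And>k. N \<le> k \<Longrightarrow> inverse (real (Suc k)) < e / 3"
      using order_tendstoD(2) [OF inv e] by (auto simp: eventually_sequentially)
    have "inverse (Suc m) + hnorm cmpl (x m - x k) + inverse (Suc k) < e"
      if "max M N \<le> m" "max M N \<le> k" for m k
    proof -
      have "hnorm cmpl (x m - x k) < e / 3"
        using M that by simp
      then show ?thesis
        using N [of m] N [of k] that by simp
    qed
    then show "\<exists>N. \<forall>m\<ge>N. \<forall>k\<ge>N. inverse (Suc m) + hnorm cmpl (x m - x k) + inverse (Suc k) < e"
      by blast
  qed
  note c = this
  show ?thesis
  proof
    show "cls a \<in> vecs cmpl"
      by (rule cls_mem [OF c])
    show "(\<lambda>k. hnorm cmpl (x k - cls a)) \<longlonglongrightarrow> 0"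
    proof (rule Lim_null_comparison [OF always_eventually])
      show "(\<lambda>k. inverse (Suc k) + hnorm cmpl (cls a - incl (a k))) \<longlonglongrightarrow> 0"
        using inv incl_tendsto_cls [OF c] by (rule tendsto_add_zero)
      show "\<forall>k. norm (hnorm cmpl (x k - cls a)) \<le> inverse (Suc k) + hnorm cmpl (cls a - incl (a k))"
      proof
        fix k
        show "norm (hnorm cmpl (x k - cls a)) \<le> inverse (Suc k) + hnorm cmpl (cls a - incl (a k))"
          using cmpl.hnorm_diff_triangle [of "x k" "incl (a k)" "cls a"] near [of k]
            cmpl.hnorm_minus_commute [of "incl (a k)" "cls a"] x a c
          by (simp add: incl_mem cls_mem)
      qed
    qed
  qed
qed

lemma vecs_uminus: "x \<in> vecs cmpl \<longleftrightarrow> - x \<in> vecs cmpl"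
  using cmpl.diff_mem [of 0 x] cmpl.diff_mem [of 0 "- x"] by auto

lemma Metric_space_cmpl: "Metric_space (vecs cmpl) (\<lambda>x y. hnorm cmpl (x - y))"
proof
  have off: "hnorm cmpl z = 0" if "z \<notin> vecs cmpl" for z
    using that by (simp add: hnorm_def cmpl_def)
  show "0 \<le> hnorm cmpl (x - y)" for x y
    using off by (cases "x - y \<in> vecs cmpl") auto
  show "hnorm cmpl (x - y) = hnorm cmpl (y - x)" for x y
  proof (cases "x - y \<in> vecs cmpl")
    case True
    then show ?thesis
      using cmpl.hnorm_minus_commute [of "x - y" 0] by simp
  next
    case False
    then show ?thesis
      using off vecs_uminus [of "x - y"] by simp
  qed
  show "hnorm cmpl (x - y) = 0 \<longleftrightarrow> x = y" if "x \<in> vecs cmpl" "y \<in> vecs cmpl" for x y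
    using that cmpl_definite [of "x - y"] by auto
  show "hnorm cmpl (x - z) \<le> hnorm cmpl (x - y) + hnorm cmpl (y - z)"
    if "x \<in> vecs cmpl" "y \<in> vecs cmpl" "z \<in> vecs cmpl" for x y z
    using that by (rule cmpl.hnorm_diff_triangle)
qed

theorem complex_hilbert_space_cmpl: "complex_hilbert_space cmpl"
proof (intro complex_hilbert_space.intro)
  interpret M: Metric_space "vecs cmpl" "\<lambda>x y. hnorm cmpl (x - y)"
    by (rule Metric_space_cmpl)
  show "M.mcomplete"
    unfolding M.mcomplete_def
  proof (intro allI impI)
    fix x
    assume cauchy: "M.MCauchy x"
    have "\<exists>l\<in>vecs cmpl. (\<lambda>k. hnorm cmpl (x k - l)) \<longlonglongrightarrow> 0"
    proof (rule cmpl_complete)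
      show "x k \<in> vecs cmpl" for k
        using cauchy by (auto simp: M.MCauchy_def)
      show "\<exists>N. \<forall>m\<ge>N. \<forall>k\<ge>N. hnorm cmpl (x m - x k) < e" if "0 < e" for e
        using cauchy that unfolding M.MCauchy_def by meson
    qed
    then obtain l where "l \<in> vecs cmpl" "(\<lambda>k. hnorm cmpl (x k - l)) \<longlonglongrightarrow> 0" ..
    moreover have "x k \<in> vecs cmpl" for k
      using cauchy by (auto simp: M.MCauchy_def)
    ultimately show "\<exists>l. limitin M.mtopology x l sequentially"
      by (auto simp: M.limitin_metric dest: order_tendstoD(2) intro!: exI [of _ l])
  qed
  show "\<lbrakk>x \<in> vecs cmpl; ip cmpl x x = 0\<rbrakk> \<Longrightarrow> x = 0" for x
    by (rule cmpl_definite) (simp_all add: hnorm_def)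
qed (fact cmpl.vector_space cmpl.subspace cmpl.ip_add cmpl.ip_scl cmpl.ip_cnj cmpl.ip_nonneg)+

definition extension :: "('a \<Rightarrow> 'a) \<Rightarrow> 'b \<Rightarrow> 'b" where
  "extension T x = cls (\<lambda>k. T (coord x k))"

text \<open>
  A bounded operator maps null sequences to null sequences, so the choice of the representative is
  immaterial.
\<close>

lemma extension_cls:
  assumes T: "bounded_operator H T" and s: "cauchy_seq s"
  shows "extension T (cls s) = cls (\<lambda>k. T (s k))"
proof -
  have "null_seq (\<lambda>k. T (s k - coord (cls s) k))"
    by (rule null_seq_bounded_operator [OF T null_seq_coord_cls])
  then have "null_seq (\<lambda>k. T (s k) - T (coord (cls s) k))"
    using s cauchy_seq_coord_cls [OF s]
    by (simp add: bounded_operator_diff [OF T] cauchy_seq_mem)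
  then show ?thesis
    using cls_null cls_diff by (fastforce simp: extension_def)
qed

lemma extension_incl:
  assumes "bounded_operator H T" "a \<in> vecs H"
  shows "extension T (incl a) = incl (T a)"
  unfolding incl_def by (rule extension_cls) (use assms in \<open>simp_all add: cauchy_seq_const\<close>)

lemma bounded_operator_extension:
  assumes T: "bounded_operator H T"
  shows "bounded_operator cmpl (extension T)"
proof -
  obtain B where B: "0 < B" "\<And>x. x \<in> vecs H \<Longrightarrow> hnorm H (T x) \<le> B * hnorm H x"
    using bounded_operator_bound [OF T] by blast
  note TC = cauchy_seq_bounded_operator [OF T]
  show ?thesis
  proof (rule cmpl.bounded_operatorI)
    fix x
    assume "x \<in> vecs cmpl"
    then obtain s where s: "cauchy_seq s" "x = cls s"
      by (meson cmpl_cases)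
    show "extension T x \<in> vecs cmpl"
      unfolding s extension_cls [OF T s(1)] by (rule cls_mem [OF TC [OF s(1)]])
    show "hnorm cmpl (extension T x) \<le> B * hnorm cmpl x"
      unfolding s extension_cls [OF T s(1)]
      by (rule LIMSEQ_le [OF hnorm_cls [OF TC [OF s(1)]] tendsto_mult_left [OF hnorm_cls [OF s(1)]]])
        (use s B in \<open>simp add: cauchy_seq_mem\<close>)
    show "extension T (scl cmpl c x) = scl cmpl c (extension T x)" for c
      using cauchy_seq_bounded_operator [OF bounded_operator_scalar s(1), of c] s
      by (simp add: extension_cls [OF T] bounded_operator_scl [OF T] cauchy_seq_mem flip: cls_scl)
  next
    fix x y
    assume "x \<in> vecs cmpl" "y \<in> vecs cmpl"
    then obtain s t where s: "cauchy_seq s" "x = cls s" and t: "cauchy_seq t" "y = cls t"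
      by (meson cmpl_cases)
    then show "extension T (x + y) = extension T x + extension T y"
      using cauchy_seq_add [OF s(1) t(1)]
      by (simp add: extension_cls [OF T] bounded_operator_add [OF T] cauchy_seq_mem flip: cls_add)
  qed
qed

end

section \<open>Functions vanishing at infinity\<close>

lemma C0_bounded:
  assumes f: "f \<in> C0 X"
  obtains M where "0 < M" "\<And>x. cmod (f x) \<le> M"
proof -
  let ?K = "{x \<in> topspace X. 1 \<le> cmod (f x)}"
  have "compactin X ?K" and "continuous_map X euclidean f"
    using f by (auto simp: C0_def)
  then have "compact (f ` ?K)"
    using image_compactin [of X ?K euclidean f] by simp
  then obtain B where B: "\<And>x. x \<in> ?K \<Longrightarrow> cmod (f x) \<le> B"
    using compact_imp_bounded bounded_iff by (metis imageI)
  have "cmod (f x) \<le> max 1 B" for x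
  proof (cases "x \<in> ?K")
    case True
    then show ?thesis using B by fastforce
  next
    case False
    then show ?thesis using f by (cases "x \<in> topspace X") (auto simp: C0_def)
  qed
  then show ?thesis
    using that [of "max 1 B"] by simp
qed

lemma C0I:
  assumes cont: "continuous_map X euclidean f" and off: "\<And>x. x \<notin> topspace X \<Longrightarrow> f x = 0"
    and K: "\<And>\<epsilon>. 0 < \<epsilon> \<Longrightarrow> \<exists>K. compactin X K \<and> {x \<in> topspace X. \<epsilon> \<le> cmod (f x)} \<subseteq> K"
  shows "f \<in> C0 X"
proof -
  have "compactin X {x \<in> topspace X. \<epsilon> \<le> cmod (f x)}" if pos: "0 < \<epsilon>" for \<epsilon>
  proof -
    obtain K where "compactin X K" "{x \<in> topspace X. \<epsilon> \<le> cmod (f x)} \<subseteq> K"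
      using K [OF pos] by blast
    moreover have "closed {z :: complex. \<epsilon> \<le> cmod z}"
      by (intro closed_Collect_le continuous_intros)
    then have "closedin X {x \<in> topspace X. \<epsilon> \<le> cmod (f x)}"
      using closedin_continuous_map_preimage [OF cont, of "{z. \<epsilon> \<le> cmod z}"] by simp
    ultimately show ?thesis
      by (rule closed_compactin)
  qed
  with cont off show ?thesis
    by (simp add: C0_def)
qed

lemma C0_compose:
  assumes f: "f \<in> C0 X" and \<phi>: "continuous_on UNIV \<phi>" and c: "0 < c"
    and bound: "\<And>x. cmod (\<phi> (f x)) \<le> c * cmod (f x)"
  shows "(\<lambda>x. \<phi> (f x)) \<in> C0 X"
proof (rule C0I)
  show "continuous_map X euclidean (\<lambda>x. \<phi> (f x))"
    using continuous_map_compose [of X euclidean f euclidean \<phi>] f \<phi>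
    by (simp add: C0_def o_def)
  show "\<phi> (f x) = 0" if "x \<notin> topspace X" for x
    using bound [of x] f that by (simp add: C0_def)
  fix \<epsilon> :: real
  assume "0 < \<epsilon>"
  then have "compactin X {x \<in> topspace X. \<epsilon> / c \<le> cmod (f x)}"
    using f c by (simp add: C0_def)
  moreover have "{x \<in> topspace X. \<epsilon> \<le> cmod (\<phi> (f x))} \<subseteq> {x \<in> topspace X. \<epsilon> / c \<le> cmod (f x)}"
    using c order_trans [OF _ bound] by (auto simp: field_simps)
  ultimately show "\<exists>K. compactin X K \<and> {x \<in> topspace X. \<epsilon> \<le> cmod (\<phi> (f x))} \<subseteq> K"
    by blast
qed

lemma C0_cnj: "f \<in> C0 X \<Longrightarrow> (\<lambda>x. cnj (f x)) \<in> C0 X"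
  by (rule C0_compose [where c = 1]) (auto intro!: continuous_intros)

lemma C0_scl: "f \<in> C0 X \<Longrightarrow> (\<lambda>x. c * f x) \<in> C0 X"
  by (rule C0_compose [where c = "cmod c + 1"])
    (auto intro!: continuous_intros mult_right_mono simp: norm_mult add_nonneg_pos)

lemma C0_add:
  assumes f: "f \<in> C0 X" and g: "g \<in> C0 X"
  shows "(\<lambda>x. f x + g x) \<in> C0 X"
proof (rule C0I)
  show "continuous_map X euclidean (\<lambda>x. f x + g x)"
    using f g by (auto simp: C0_def intro: continuous_map_add)
  fix \<epsilon> :: real
  assume "0 < \<epsilon>"
  let ?K = "\<lambda>h. {x \<in> topspace X. \<epsilon> / 2 \<le> cmod (h x)}"
  have "compactin X (?K h)" if "h \<in> C0 X" for h
    using that half_gt_zero [OF \<open>0 < \<epsilon>\<close>] unfolding C0_def by blast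
  then have "compactin X (?K f \<union> ?K g)"
    using f g by (intro compactin_Un)
  moreover have "{x \<in> topspace X. \<epsilon> \<le> cmod (f x + g x)} \<subseteq> ?K f \<union> ?K g"
  proof
    fix x
    assume "x \<in> {x \<in> topspace X. \<epsilon> \<le> cmod (f x + g x)}"
    then show "x \<in> ?K f \<union> ?K g"
      using norm_triangle_ineq [of "f x" "g x"] by simp linarith
  qed
  ultimately show "\<exists>K. compactin X K \<and> {x \<in> topspace X. \<epsilon> \<le> cmod (f x + g x)} \<subseteq> K"
    by blast
qed (use f g in \<open>simp add: C0_def\<close>)

lemma C0_mult:
  assumes f: "f \<in> C0 X" and g: "g \<in> C0 X"
  shows "(\<lambda>x. f x * g x) \<in> C0 X"
proof (rule C0I)
  show "continuous_map X euclidean (\<lambda>x. f x * g x)"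
    using f g by (auto simp: C0_def continuous_map_atin intro: tendsto_mult)
  obtain M where M: "0 < M" "\<And>x. cmod (g x) \<le> M"
    using C0_bounded [OF g] by blast
  fix \<epsilon> :: real
  assume "0 < \<epsilon>"
  have "cmod (f x * g x) \<le> cmod (f x) * M" for x
    using M by (simp add: norm_mult mult_left_mono)
  then have "{x \<in> topspace X. \<epsilon> \<le> cmod (f x * g x)} \<subseteq> {x \<in> topspace X. \<epsilon> / M \<le> cmod (f x)}"
    using M order_trans by (fastforce simp: field_simps)
  moreover have "compactin X {x \<in> topspace X. \<epsilon> / M \<le> cmod (f x)}"
    using f M \<open>0 < \<epsilon>\<close> by (simp add: C0_def)
  ultimately show "\<exists>K. compactin X K \<and> {x \<in> topspace X. \<epsilon> \<le> cmod (f x * g x)} \<subseteq> K"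
    by blast
qed (use f g in \<open>simp add: C0_def\<close>)

lemma C0_pullback:
  assumes f: "f \<in> C0 X" and s: "continuous_map X X s" "proper_map X X s"
  shows "pullback X f s \<in> C0 X"
proof -
  have eq: "{x \<in> topspace X. \<epsilon> \<le> cmod (pullback X f s x)}
      = {x \<in> topspace X. s x \<in> {y \<in> topspace X. \<epsilon> \<le> cmod (f y)}}" for \<epsilon>
    using continuous_map_image_subset_topspace [OF s(1)] by (auto simp: pullback_def)
  have "continuous_map X euclidean (f \<circ> s)"
    using f s by (auto simp: C0_def intro: continuous_map_compose)
  then have "continuous_map X euclidean (pullback X f s)"
    by (rule continuous_map_eq) (simp add: pullback_def)
  moreover have "compactin X {x \<in> topspace X. \<epsilon> \<le> cmod (pullback X f s x)}" if "0 < \<epsilon>" for \<epsilon>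
    unfolding eq by (rule compactin_proper_map_preimage [OF s(2)]) (use f that in \<open>simp add: C0_def\<close>)
  ultimately show ?thesis
    by (simp add: C0_def pullback_def)
qed

text \<open>
  Positivity of \<open>M\<^sup>2 - \<bar>f\<bar>\<^sup>2\<close> gives the bound, but this function need not vanish at infinity, nor
  need its square root. With \<open>q = 1 - sqrt (1 - \<bar>f\<bar>\<^sup>2 / M\<^sup>2)\<close>, which does belong to
  \<open>C0 X\<close>, its square root is \<open>M (1 - q)\<close>. Hence \<open>\<bar>f\<bar>\<^sup>2 = M\<^sup>2 (2 q - q\<^sup>2)\<close>, and
  \<open>M\<^sup>2 \<parallel>x\<parallel>\<^sup>2 - \<parallel>T f x\<parallel>\<^sup>2 = M\<^sup>2 \<parallel>x - T q x\<parallel>\<^sup>2\<close>. This bound is what lets the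
  representation on the algebraic dilation space extend to the completion.
\<close>

lemma (in semi_inner_product_space) star_homomorphism_contractive:
  assumes mem: "\<And>f x. \<lbrakk>f \<in> C0 X; x \<in> vecs H\<rbrakk> \<Longrightarrow> T f x \<in> vecs H"
    and add: "\<And>f g x. \<lbrakk>f \<in> C0 X; g \<in> C0 X; x \<in> vecs H\<rbrakk> \<Longrightarrow> T (\<lambda>t. f t + g t) x = T f x + T g x"
    and scl: "\<And>c f x. \<lbrakk>f \<in> C0 X; x \<in> vecs H\<rbrakk> \<Longrightarrow> T (\<lambda>t. c * f t) x = scl H c (T f x)"
    and mult: "\<And>f g x. \<lbrakk>f \<in> C0 X; g \<in> C0 X; x \<in> vecs H\<rbrakk> \<Longrightarrow> T (\<lambda>t. f t * g t) x = T f (T g x)"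
    and star: "\<And>f x y. \<lbrakk>f \<in> C0 X; x \<in> vecs H; y \<in> vecs H\<rbrakk>
                 \<Longrightarrow> ip H (T f x) y = ip H x (T (\<lambda>t. cnj (f t)) y)"
    and f: "f \<in> C0 X" and M: "0 < M" "\<And>t. cmod (f t) \<le> M" and x: "x \<in> vecs H"
  shows "hnorm H (T f x) \<le> M * hnorm H x"
proof -
  define r where "r = (\<lambda>z :: complex. 1 - sqrt (1 - (cmod z / M)\<^sup>2))"
  define q where "q = (\<lambda>t. complex_of_real (r (f t)))"
  have u: "0 \<le> (cmod (f t) / M)\<^sup>2" "(cmod (f t) / M)\<^sup>2 \<le> 1" for t
    using M by (auto simp: power_le_one)
  have r0: "0 \<le> r (f t)" and r1: "r (f t) \<le> 1" for t
    using u [of t] by (auto simp: r_def)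
  have r2: "2 * r (f t) - (r (f t))\<^sup>2 = (cmod (f t) / M)\<^sup>2" for t
  proof -
    have "(1 - r (f t))\<^sup>2 = 1 - (cmod (f t) / M)\<^sup>2"
      using u [of t] by (simp add: r_def)
    then show ?thesis by (simp add: power2_diff)
  qed
  have q: "q \<in> C0 X"
    unfolding q_def
  proof (rule C0_compose [OF f])
    show "continuous_on UNIV (\<lambda>z. complex_of_real (r z))"
      unfolding r_def using M by (intro continuous_intros) auto
    show "0 < 1 / M"
      using M by simp
    show "cmod (complex_of_real (r (f t))) \<le> 1 / M * cmod (f t)" for t
    proof -
      have "r (f t) * r (f t) \<le> 1 * r (f t)"
        using r0 r1 by (intro mult_right_mono)
      then have "r (f t) \<le> (cmod (f t) / M)\<^sup>2"
        using r2 [of t] by (simp add: power2_eq_square)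
      also have "\<dots> \<le> cmod (f t) / M"
        using M power_decreasing [of 1 2 "cmod (f t) / M"] by simp
      finally show ?thesis
        using r0 [of t] by simp
    qed
  qed
  have qq: "(\<lambda>t. q t * q t) \<in> C0 X"
    by (rule C0_mult [OF q q])
  note tq = C0_scl [OF q, of 2] and nqq = C0_scl [OF qq, of "- 1"]
  note p = C0_add [OF tq nqq]
  \<comment> \<open>The summands have this form so that the algebraic laws of \<open>T\<close> apply to them syntactically.\<close>
  have ff: "(\<lambda>t. cnj (f t) * f t) = (\<lambda>t. of_real (M\<^sup>2) * (2 * q t + - 1 * (q t * q t)))"
  proof
    fix t
    have "cnj (f t) * f t = complex_of_real ((cmod (f t))\<^sup>2)"
      by (simp only: complex_norm_square mult.commute)
    also have "(cmod (f t))\<^sup>2 = M\<^sup>2 * (2 * r (f t) - (r (f t))\<^sup>2)"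
      unfolding r2 using M by (simp add: power_divide)
    finally show "cnj (f t) * f t = of_real (M\<^sup>2) * (2 * q t + - 1 * (q t * q t))"
      by (simp add: q_def power2_eq_square)
  qed
  define y where "y = T q x"
  have y: "y \<in> vecs H"
    using mem q x by (simp add: y_def)
  have "T (\<lambda>t. cnj (f t)) (T f x) = scl H (of_real (M\<^sup>2)) (scl H 2 y - T q y)"
  proof -
    have "T (\<lambda>t. cnj (f t)) (T f x) = T (\<lambda>t. cnj (f t) * f t) x"
      using mult [OF C0_cnj [OF f] f x] by simp
    also have "\<dots> = scl H (of_real (M\<^sup>2)) (T (\<lambda>t. 2 * q t + - 1 * (q t * q t)) x)"
      unfolding ff by (rule scl [OF p x])
    also have "T (\<lambda>t. 2 * q t + - 1 * (q t * q t)) x = scl H 2 y - T q y"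
      unfolding add [OF tq nqq x] scl [OF q x] scl [OF qq x] mult [OF q q x] y_def by simp
    finally show ?thesis .
  qed
  then have "(hnorm H (T f x))\<^sup>2 = Re (ip H x (scl H (of_real (M\<^sup>2)) (scl H 2 y - T q y)))"
    using star [OF f x mem [OF f x]] mem f x by (simp add: hnorm_sq)
  also have "\<dots> = M\<^sup>2 * (2 * Re (ip H x y) - Re (ip H x (T q y)))"
    using x y mem q by (simp add: ip_scl_right ip_diff_right)
  also have "ip H x (T q y) = ip H y y"
    using star [OF q x y] by (simp add: y_def [symmetric], simp add: q_def)
  also have "2 * Re (ip H x y) - Re (ip H y y) = (hnorm H x)\<^sup>2 - (hnorm H (x - y))\<^sup>2"
    using x y by (simp add: hnorm_diff_sq, simp add: hnorm_sq)
  also have "M\<^sup>2 * \<dots> \<le> (M * hnorm H x)\<^sup>2"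
    by (simp add: power_mult_distrib mult_left_mono)
  finally show ?thesis
    by (rule power2_le_imp_le) (use M x in simp)
qed

section \<open>The algebraic dilation space\<close>

lemma sum_fun_apply: "(\<Sum>i\<in>I. f i) v = (\<Sum>i\<in>I. f i v)"
  by (induction I rule: infinite_finite_induct) auto

lemma cnj_Sum_any: "cnj (Sum_any g) = Sum_any (\<lambda>w. cnj (g w))"
  by (simp add: Sum_any.expand_set)

lemma Sum_any_words:
  fixes g :: "'i list \<Rightarrow> 'c::comm_monoid_add"
  assumes fin: "finite {w. g w \<noteq> 0}" and I: "finite I" "\<And>w. g w \<noteq> 0 \<Longrightarrow> set w \<subseteq> I"
  shows "Sum_any g = g [] + (\<Sum>i\<in>I. Sum_any (\<lambda>w. g (i # w)))"
proof -
  define T where "T i = {w. g (i # w) \<noteq> 0}" for i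
  have T: "finite (T i)" for i
  proof -
    have "finite (Cons i -` {w. g w \<noteq> 0})"
      by (rule finite_vimageI [OF fin]) simp
    then show ?thesis
      by (simp add: T_def vimage_def)
  qed
  define U where "U = (\<lambda>(i, w). i # w) ` Sigma I T"
  have U: "finite U" "[] \<notin> U"
    using T I by (auto simp: U_def)
  have "{w. g w \<noteq> 0} \<subseteq> insert [] U"
  proof
    fix w
    assume w: "w \<in> {w. g w \<noteq> 0}"
    then show "w \<in> insert [] U"
      using I(2) [of w] by (cases w) (auto simp: U_def T_def)
  qed
  then have "Sum_any g = sum g (insert [] U)"
    using U by (intro Sum_any.expand_superset) auto
  also have "\<dots> = g [] + sum g U"
    using U by simp
  also have "sum g U = (\<Sum>(i, w)\<in>Sigma I T. g (i # w))"
    unfolding U_def by (subst sum.reindex) (auto simp: inj_on_def case_prod_unfold)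
  also have "\<dots> = (\<Sum>i\<in>I. \<Sum>w\<in>T i. g (i # w))"
    using I T by (intro sum.Sigma [symmetric]) auto
  also have "\<dots> = (\<Sum>i\<in>I. Sum_any (\<lambda>w. g (i # w)))"
    by (simp add: Sum_any.expand_set T_def)
  finally show ?thesis .
qed

locale covariant_representation =
  multivariable_dynamical_system X n \<sigma> + H: complex_hilbert_space H
  for X :: "'x topology" and n :: nat and \<sigma> :: "nat \<Rightarrow> 'x \<Rightarrow> 'x"
    and H :: "'h::ab_group_add hilbert" +
  fixes \<pi> :: "('x \<Rightarrow> complex) \<Rightarrow> 'h \<Rightarrow> 'h" and A :: "nat \<Rightarrow> 'h \<Rightarrow> 'h"
  assumes star_representation: "star_representation X H \<pi>"
    and row_contraction: "row_contraction H n A"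
    and covariant: "covariant X n \<sigma> H \<pi> A"
begin

lemma pi_bounded: "f \<in> C0 X \<Longrightarrow> bounded_operator H (\<pi> f)"
  using star_representation by (simp add: star_representation_def)

lemma
  assumes "f \<in> C0 X" "x \<in> vecs H"
  shows pi_add: "g \<in> C0 X \<Longrightarrow> \<pi> (\<lambda>t. f t + g t) x = \<pi> f x + \<pi> g x"
    and pi_scl: "\<pi> (\<lambda>t. c * f t) x = scl H c (\<pi> f x)"
    and pi_mult: "g \<in> C0 X \<Longrightarrow> \<pi> (\<lambda>t. f t * g t) x = \<pi> f (\<pi> g x)"
    and pi_star: "y \<in> vecs H \<Longrightarrow> ip H (\<pi> f x) y = ip H x (\<pi> (\<lambda>t. cnj (f t)) y)"
    and pi_covariant: "i \<in> {1..n} \<Longrightarrow> \<pi> f (A i x) = A i (\<pi> (pullback X f (\<sigma> i)) x)"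
  using star_representation covariant assms
  by (simp_all add: star_representation_def covariant_def)

lemmas pi_mem = H.bounded_operator_mem [OF pi_bounded]

lemma A_bounded: "i \<in> {1..n} \<Longrightarrow> bounded_operator H (A i)"
  using row_contraction by (simp add: row_contraction_def)

lemmas A_mem = H.bounded_operator_mem [OF A_bounded]

lemma row_mem: "(\<And>j. j \<in> {1..n} \<Longrightarrow> h j \<in> vecs H) \<Longrightarrow> (\<Sum>j\<in>{1..n}. A j (h j)) \<in> vecs H"
  by (intro H.sum_mem A_mem)

text \<open>
  The supremum that defines the operator norm is a bound for its elements only once it is
  known to be taken over a bounded set; boundedness of the entries of the row provides this.
\<close>

lemma row_contractive:
  assumes h: "\<And>j. j \<in> {1..n} \<Longrightarrow> h j \<in> vecs H"
  shows "(hnorm H (\<Sum>j\<in>{1..n}. A j (h j)))\<^sup>2 \<le> (\<Sum>j\<in>{1..n}. (hnorm H (h j))\<^sup>2)"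
proof -
  have "\<forall>j\<in>{1..n}. \<exists>B>0. \<forall>x\<in>vecs H. hnorm H (A j x) \<le> B * hnorm H x"
    using H.bounded_operator_bound [OF A_bounded] by blast
  then obtain B where B: "\<And>j. j \<in> {1..n} \<Longrightarrow> 0 < B j"
    and AB: "\<And>j x. \<lbrakk>j \<in> {1..n}; x \<in> vecs H\<rbrakk> \<Longrightarrow> hnorm H (A j x) \<le> B j * hnorm H x"
    by metis
  have bound: "hnorm H (\<Sum>j\<in>{1..n}. A j (x j)) \<le> (\<Sum>j\<in>{1..n}. B j) * column_norm H n x"
    if x: "\<And>j. j \<in> {1..n} \<Longrightarrow> x j \<in> vecs H" for x
  proof -
    have le: "hnorm H (x j) \<le> column_norm H n x" if "j \<in> {1..n}" for j
    proof -
      have "(hnorm H (x j))\<^sup>2 \<le> (\<Sum>i\<in>{1..n}. (hnorm H (x i))\<^sup>2)"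
        using that by (intro member_le_sum) auto
      then show ?thesis
        unfolding column_norm_def by (rule real_le_rsqrt)
    qed
    have "hnorm H (\<Sum>j\<in>J. A j (x j)) \<le> (\<Sum>j\<in>J. B j * hnorm H (x j))"
      if "J \<subseteq> {1..n}" "finite J" for J
      using that(2,1)
    proof (induction J)
      case (insert i J)
      have "hnorm H (A i (x i) + (\<Sum>j\<in>J. A j (x j))) \<le> hnorm H (A i (x i)) + hnorm H (\<Sum>j\<in>J. A j (x j))"
        using insert.prems x by (intro H.hnorm_triangle H.sum_mem A_mem) auto
      with insert AB [of i "x i"] x [of i] show ?case
        by simp
    qed simp
    from this [of "{1..n}"] have "hnorm H (\<Sum>j\<in>{1..n}. A j (x j)) \<le> (\<Sum>j\<in>{1..n}. B j * hnorm H (x j))"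
      by simp
    also have "\<dots> \<le> (\<Sum>j\<in>{1..n}. B j * column_norm H n x)"
      using B le by (intro sum_mono mult_left_mono) (auto simp: less_imp_le)
    finally show ?thesis
      by (simp add: sum_distrib_right)
  qed
  have unit: "hnorm H (row_apply n A x) \<le> 1" if x: "x \<in> {1..n} \<rightarrow> vecs H" "column_norm H n x \<le> 1" for x
  proof -
    have "bdd_above ((\<lambda>x. hnorm H (row_apply n A x)) ` {x \<in> {1..n} \<rightarrow> vecs H. column_norm H n x \<le> 1})"
    proof (rule bdd_aboveI2)
      fix x
      assume x: "x \<in> {x \<in> {1..n} \<rightarrow> vecs H. column_norm H n x \<le> 1}"
      then have "hnorm H (row_apply n A x) \<le> (\<Sum>j\<in>{1..n}. B j) * column_norm H n x"
        unfolding row_apply_def by (intro bound) auto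
      also have "\<dots> \<le> (\<Sum>j\<in>{1..n}. B j) * 1"
        using x B by (intro mult_left_mono sum_nonneg) (auto simp: less_imp_le)
      finally show "hnorm H (row_apply n A x) \<le> (\<Sum>j\<in>{1..n}. B j)"
        by simp
    qed
    then have "hnorm H (row_apply n A x) \<le> row_opnorm H n A"
      unfolding row_opnorm_def using x by (intro cSUP_upper) auto
    with row_contraction show ?thesis
      by (simp add: row_contraction_def)
  qed
  define c where "c = column_norm H n h"
  have c0: "0 \<le> c"
    by (simp add: c_def column_norm_def sum_nonneg)
  have "hnorm H (\<Sum>j\<in>{1..n}. A j (h j)) \<le> c"
  proof (cases "c = 0")
    case True
    with bound [of h] h show ?thesis by (simp add: c_def)
  next
    case False
    with c0 have c: "0 < c" by simp
    define x where "x j = scl H (of_real (1 / c)) (h j)" for j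
    have "column_norm H n x = sqrt ((\<Sum>j\<in>{1..n}. (hnorm H (h j))\<^sup>2) / c\<^sup>2)"
      using h c by (simp add: column_norm_def x_def H.hnorm_scl power_mult_distrib power_divide norm_divide sum_divide_distrib)
    also have "\<dots> = c / c"
      using c by (simp add: real_sqrt_divide c_def column_norm_def)
    finally have "hnorm H (row_apply n A x) \<le> 1"
      using h c by (intro unit) (auto simp: x_def)
    moreover have "row_apply n A x = scl H (of_real (1 / c)) (\<Sum>j\<in>{1..n}. A j (h j))"
      using h by (simp add: row_apply_def x_def H.bounded_operator_scl [OF A_bounded] H.vs.scale_sum_right)
    ultimately show ?thesis
      using c row_mem h by (simp add: H.hnorm_scl norm_divide field_simps)
  qed
  then have "(hnorm H (\<Sum>j\<in>{1..n}. A j (h j)))\<^sup>2 \<le> c\<^sup>2"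
    using row_mem h by (intro power_mono) auto
  then show ?thesis
    by (simp add: c_def column_norm_def sum_nonneg)
qed

text \<open>
  The semi-inner product \<open>\<langle>(I - A\<^sup>* A) h, k\<rangle>\<close> on \<open>H\<^sup>(\<^sup>n\<^sup>)\<close>.
\<close>

definition defect :: "(nat \<Rightarrow> 'h) \<Rightarrow> (nat \<Rightarrow> 'h) \<Rightarrow> complex" where
  "defect h k = (\<Sum>j\<in>{1..n}. ip H (h j) (k j)) - ip H (\<Sum>j\<in>{1..n}. A j (h j)) (\<Sum>j\<in>{1..n}. A j (k j))"

lemma defect_cong:
  assumes "\<And>j. j \<in> {1..n} \<Longrightarrow> h j = h' j" "\<And>j. j \<in> {1..n} \<Longrightarrow> k j = k' j"
  shows "defect h k = defect h' k'"
  unfolding defect_def using assms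
  by (intro arg_cong2 [where f = "(-)"] arg_cong2 [where f = "ip H"] sum.cong) auto

lemma defect_add:
  assumes "\<And>j. h j \<in> vecs H" "\<And>j. h' j \<in> vecs H" "\<And>j. k j \<in> vecs H"
  shows "defect (\<lambda>j. h j + h' j) k = defect h k + defect h' k"
proof -
  have "(\<Sum>j\<in>{1..n}. A j (h j + h' j)) = (\<Sum>j\<in>{1..n}. A j (h j)) + (\<Sum>j\<in>{1..n}. A j (h' j))"
    using assms by (simp add: H.bounded_operator_add [OF A_bounded] flip: sum.distrib)
  then show ?thesis
    using assms row_mem by (simp add: defect_def H.ip_add sum.distrib)
qed

lemma defect_scl:
  assumes "\<And>j. h j \<in> vecs H" "\<And>j. k j \<in> vecs H"
  shows "defect (\<lambda>j. scl H c (h j)) k = c * defect h k"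
proof -
  have "(\<Sum>j\<in>{1..n}. A j (scl H c (h j))) = scl H c (\<Sum>j\<in>{1..n}. A j (h j))"
    using assms by (simp add: H.bounded_operator_scl [OF A_bounded] H.vs.scale_sum_right)
  then show ?thesis
    using assms row_mem by (simp add: defect_def H.ip_scl right_diff_distrib sum_distrib_left)
qed

lemma defect_cnj:
  assumes "\<And>j. h j \<in> vecs H" "\<And>j. k j \<in> vecs H"
  shows "defect k h = cnj (defect h k)"
  using H.ip_cnj [OF row_mem row_mem, of h k] assms
  by (simp add: defect_def H.ip_cnj [of "h _" "k _"])

lemma defect_nonneg:
  assumes "\<And>j. h j \<in> vecs H"
  shows "0 \<le> Re (defect h h)"
  using row_contractive [of h] row_mem [of h] assms by (simp add: defect_def H.hnorm_sq)

lemma defect_zero: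
  assumes "\<And>j. k j \<in> vecs H"
  shows "defect (\<lambda>j. 0) k = 0" and "defect k (\<lambda>j. 0) = 0"
  using assms row_mem by (simp_all add: defect_def H.bounded_operator_zero [OF A_bounded])

lemma pullback_C0: "\<lbrakk>f \<in> C0 X; i \<in> {1..n}\<rbrakk> \<Longrightarrow> pullback X f (\<sigma> i) \<in> C0 X"
  by (intro C0_pullback continuous proper)

text \<open>
  By covariance the row \<open>A\<close> intertwines the representation \<open>f \<mapsto> \<Oplus>\<^sub>j \<pi> (f \<circ> \<sigma>\<^sub>j)\<close> of \<open>H\<^sup>(\<^sup>n\<^sup>)\<close> with \<open>\<pi>\<close>, so
  the \<open>*\<close>-relation holds for both terms of the defect form.
\<close>

lemma defect_star:
  assumes f: "f \<in> C0 X" and h: "\<And>j. h j \<in> vecs H" and k: "\<And>j. k j \<in> vecs H"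
  shows "defect (\<lambda>j. \<pi> (pullback X f (\<sigma> j)) (h j)) k
       = defect h (\<lambda>j. \<pi> (pullback X (\<lambda>t. cnj (f t)) (\<sigma> j)) (k j))"
proof -
  have row: "(\<Sum>j\<in>{1..n}. A j (\<pi> (pullback X g (\<sigma> j)) (u j))) = \<pi> g (\<Sum>j\<in>{1..n}. A j (u j))"
    if "g \<in> C0 X" "\<And>j. u j \<in> vecs H" for g u
  proof -
    have "\<pi> g (\<Sum>j\<in>J. A j (u j)) = (\<Sum>j\<in>J. \<pi> g (A j (u j)))" if "J \<subseteq> {1..n}" "finite J" for J
      using that(2,1)
    proof (induction J)
      case (insert i J)
      then have "A i (u i) \<in> vecs H" "(\<Sum>j\<in>J. A j (u j)) \<in> vecs H"
        using \<open>\<And>j. u j \<in> vecs H\<close> by (auto intro!: A_mem H.sum_mem)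
      with insert \<open>g \<in> C0 X\<close> show ?case
        by (simp add: H.bounded_operator_add [OF pi_bounded])
    qed (simp add: H.bounded_operator_zero [OF pi_bounded] \<open>g \<in> C0 X\<close>)
    with that show ?thesis
      by (simp add: pi_covariant)
  qed
  have "pullback X (\<lambda>t. cnj (f t)) (\<sigma> j) = (\<lambda>t. cnj (pullback X f (\<sigma> j) t))" for j
    by (auto simp: pullback_def)
  then have "(\<Sum>j\<in>{1..n}. ip H (\<pi> (pullback X f (\<sigma> j)) (h j)) (k j))
      = (\<Sum>j\<in>{1..n}. ip H (h j) (\<pi> (pullback X (\<lambda>t. cnj (f t)) (\<sigma> j)) (k j)))"
    using f h k by (intro sum.cong) (simp_all add: pi_star pullback_C0)
  then show ?thesis
    unfolding defect_def row [OF f h] row [OF C0_cnj [OF f] k]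
    using pi_star [OF f row_mem row_mem, of h k] h k by simp
qed

text \<open>
  The algebraic form of \<open>H \<oplus> (F \<otimes> D)\<close>. The value \<open>x []\<close> is the component in \<open>H\<close>, and the family
  of the values \<open>x (w @ [j])\<close> is the component at the basis vector \<open>e\<^sub>w\<close> of \<open>F\<close>, measured by the defect
  form.
\<close>

definition fock :: "(nat list \<Rightarrow> 'h) hilbert" where
  "fock = \<lparr>vecs = {x. (\<forall>v. x v \<in> vecs H) \<and> finite {v. x v \<noteq> 0} \<and> (\<forall>v. x v \<noteq> 0 \<longrightarrow> set v \<subseteq> {1..n})},
     scl = (\<lambda>c x v. scl H c (x v)),
     ip = (\<lambda>x y. ip H (x []) (y []) + Sum_any (\<lambda>w. defect (\<lambda>j. x (w @ [j])) (\<lambda>j. y (w @ [j]))))\<rparr>"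

lemma scl_fock [simp]: "scl fock c x v = scl H c (x v)"
  by (simp add: fock_def)

lemma ip_fock: "ip fock x y =
    ip H (x []) (y []) + Sum_any (\<lambda>w. defect (\<lambda>j. x (w @ [j])) (\<lambda>j. y (w @ [j])))"
  by (simp add: fock_def)

lemma fock_mem: "x \<in> vecs fock \<Longrightarrow> x v \<in> vecs H"
  by (simp add: fock_def)

lemma fock_support: "x \<in> vecs fock \<Longrightarrow> \<not> set v \<subseteq> {1..n} \<Longrightarrow> x v = 0"
  by (auto simp: fock_def)

lemma fock_memI:
  assumes "\<And>v. x v \<in> vecs H" "finite S" "\<And>v. x v \<noteq> 0 \<Longrightarrow> v \<in> S" "\<And>v. x v \<noteq> 0 \<Longrightarrow> set v \<subseteq> {1..n}"
  shows "x \<in> vecs fock"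
  using assms finite_subset [of "{v. x v \<noteq> 0}" S] by (auto simp: fock_def)

lemma finite_defect:
  assumes "x \<in> vecs fock" "y \<in> vecs fock"
  shows "finite {w. defect (\<lambda>j. x (w @ [j])) (\<lambda>j. y (w @ [j])) \<noteq> 0}"
proof (rule finite_subset)
  show "finite (butlast ` {v. x v \<noteq> 0})"
    using assms by (simp add: fock_def)
  show "{w. defect (\<lambda>j. x (w @ [j])) (\<lambda>j. y (w @ [j])) \<noteq> 0} \<subseteq> butlast ` {v. x v \<noteq> 0}"
  proof
    fix w
    assume "w \<in> {w. defect (\<lambda>j. x (w @ [j])) (\<lambda>j. y (w @ [j])) \<noteq> 0}"
    then obtain j where "x (w @ [j]) \<noteq> 0"
      using defect_zero(1) [of "\<lambda>j. y (w @ [j])"] assms by (fastforce simp: fock_mem)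
    then show "w \<in> butlast ` {v. x v \<noteq> 0}"
      by (intro image_eqI [where x = "w @ [j]"]) simp_all
  qed
qed

sublocale fock: semi_inner_product_space fock
proof (rule semi_inner_product_space.intro)
  show vs: "vector_space (scl fock)"
    by unfold_locales (auto simp: H.vs.scale_right_distrib H.vs.scale_left_distrib)
  interpret V: vector_space "scl fock"
    by (rule vs)
  show "V.subspace (vecs fock)"
  proof (rule V.subspaceI)
    show "0 \<in> vecs fock"
      by (rule fock_memI [where S = "{}"]) auto
    show "x + y \<in> vecs fock" if "x \<in> vecs fock" "y \<in> vecs fock" for x y
    proof (rule fock_memI)
      show "finite ({v. x v \<noteq> 0} \<union> {v. y v \<noteq> 0})"
        using that by (simp add: fock_def)
      show "set v \<subseteq> {1..n}" if "(x + y) v \<noteq> 0" for v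
        using that fock_support [OF \<open>x \<in> vecs fock\<close>, of v] fock_support [OF \<open>y \<in> vecs fock\<close>, of v]
        by (metis add_0 plus_fun_apply)
    qed (use that in \<open>auto simp: fock_mem\<close>)
    show "scl fock c x \<in> vecs fock" if "x \<in> vecs fock" for c x
    proof (rule fock_memI)
      show "finite {v. x v \<noteq> 0}"
        using that by (simp add: fock_def)
      show "set v \<subseteq> {1..n}" if "scl fock c x v \<noteq> 0" for v
        using that fock_support [OF \<open>x \<in> vecs fock\<close>, of v] by auto
    qed (use that in \<open>auto simp: fock_mem\<close>)
  qed
next
  fix x y z
  assume "x \<in> vecs fock" "y \<in> vecs fock" "z \<in> vecs fock"
  then show "ip fock (x + y) z = ip fock x z + ip fock y z"
    by (simp add: ip_fock fock_mem H.ip_add defect_add Sum_any.distrib finite_defect)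
next
  fix x y c
  assume "x \<in> vecs fock" "y \<in> vecs fock"
  then show "ip fock (scl fock c x) y = c * ip fock x y"
    by (simp add: ip_fock fock_mem H.ip_scl defect_scl distrib_left Sum_any_right_distrib finite_defect)
next
  fix x y
  assume "x \<in> vecs fock" "y \<in> vecs fock"
  then show "ip fock y x = cnj (ip fock x y)"
    by (simp add: ip_fock fock_mem H.ip_cnj [of "x _" "y _"] defect_cnj [of "\<lambda>j. x (_ @ [j])"] cnj_Sum_any)
next
  fix x
  assume "x \<in> vecs fock"
  then show "0 \<le> Re (ip fock x x)"
    by (simp add: ip_fock fock_mem H.ip_nonneg Sum_any.expand_set defect_nonneg sum_nonneg)
qed

text \<open>
  Moving values from \<open>w\<close> to \<open>i # w\<close> does two things at once: the component in \<open>H\<close> becomes the \<open>i\<close>-th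
  entry of the component at the basis vector of the empty word, and the component at \<open>e\<^sub>w\<close> becomes that at
  \<open>e\<^sub>i\<^sub>w\<close>.
\<close>

definition creation :: "nat \<Rightarrow> (nat list \<Rightarrow> 'h) \<Rightarrow> nat list \<Rightarrow> 'h" where
  "creation i x v = (case v of [] \<Rightarrow> A i (x []) | a # w \<Rightarrow> if a = i then x w else 0)"

lemma creation_simps [simp]:
  "creation i x [] = A i (x [])"
  "creation i x (a # w) = (if a = i then x w else 0)"
  by (simp_all add: creation_def)

lemma creation_mem:
  assumes i: "i \<in> {1..n}" and x: "x \<in> vecs fock"
  shows "creation i x \<in> vecs fock"
proof (rule fock_memI)
  show "creation i x v \<in> vecs H" for v
    using i x by (cases v) (simp_all add: A_mem fock_mem)
  show "finite (insert [] (Cons i ` {v. x v \<noteq> 0}))"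
    using x by (simp add: fock_def)
  show "v \<in> insert [] (Cons i ` {v. x v \<noteq> 0})" if "creation i x v \<noteq> 0" for v
    using that by (cases v) (auto split: if_splits)
  show "set v \<subseteq> {1..n}" if "creation i x v \<noteq> 0" for v
    using that i fock_support [OF x] by (cases v) (auto split: if_splits)
qed

text \<open>
  The sum of the \<open>creation i (x i)\<close> has \<open>\<Sum>\<^sub>i A\<^sub>i (x i [])\<close> as its component in \<open>H\<close>. Its component at
  the empty word of \<open>F\<close> is the family of the \<open>x i []\<close>, whose defect form is
  \<open>\<Sum>\<^sub>i \<parallel>x i []\<parallel>\<^sup>2 - \<parallel>\<Sum>\<^sub>i A\<^sub>i (x i [])\<parallel>\<^sup>2\<close>; the two contributions of the row cancel. The remaining
  components are those of the \<open>x i\<close>, at words with distinct first letters.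
\<close>

lemma row_creation_isometric:
  assumes x: "\<And>i. i \<in> {1..n} \<Longrightarrow> x i \<in> vecs fock"
  shows "(hnorm fock (\<Sum>i\<in>{1..n}. creation i (x i)))\<^sup>2 = (\<Sum>i\<in>{1..n}. (hnorm fock (x i))\<^sup>2)"
proof -
  define y where "y = (\<Sum>i\<in>{1..n}. creation i (x i))"
  have y: "y \<in> vecs fock"
    unfolding y_def using x by (intro fock.sum_mem creation_mem)
  have y0: "y [] = (\<Sum>i\<in>{1..n}. A i (x i []))"
    by (simp add: y_def sum_fun_apply)
  have y1: "y (i # w) = x i w" if "i \<in> {1..n}" for i w
    using that by (simp add: y_def sum_fun_apply)
  let ?d = "\<lambda>x w. defect (\<lambda>j. x (w @ [j])) (\<lambda>j. x (w @ [j]))"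
  have "set w \<subseteq> {1..n}" if "?d y w \<noteq> 0" for w
  proof (rule ccontr)
    assume "\<not> set w \<subseteq> {1..n}"
    then have "y (w @ [j]) = 0" for j
      by (intro fock_support [OF y]) simp
    with that show False
      by (simp add: defect_zero)
  qed
  then have "Sum_any (?d y) = ?d y [] + (\<Sum>i\<in>{1..n}. Sum_any (\<lambda>w. ?d y (i # w)))"
    by (intro Sum_any_words finite_defect y) auto
  also have "?d y [] = defect (\<lambda>j. x j []) (\<lambda>j. x j [])"
    by (rule defect_cong) (simp_all add: y1)
  also have "\<dots> = (\<Sum>i\<in>{1..n}. ip H (x i []) (x i [])) - ip H (y []) (y [])"
    by (simp add: defect_def y0)
  also have "(\<Sum>i\<in>{1..n}. Sum_any (\<lambda>w. ?d y (i # w))) = (\<Sum>i\<in>{1..n}. Sum_any (?d (x i)))"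
    by (simp add: y1)
  finally have "ip fock y y = (\<Sum>i\<in>{1..n}. ip fock (x i) (x i))"
    by (simp add: ip_fock sum.distrib)
  then have "Re (ip fock y y) = (\<Sum>i\<in>{1..n}. Re (ip fock (x i) (x i)))"
    by simp
  then show ?thesis
    unfolding y_def [symmetric] using x y by (simp add: fock.hnorm_sq)
qed

lemma creation_zero: "i \<in> {1..n} \<Longrightarrow> creation i 0 = 0"
  by (rule ext) (simp add: creation_def H.bounded_operator_zero [OF A_bounded] split: list.split)

lemma creation_isometric:
  assumes i: "i \<in> {1..n}" and x: "x \<in> vecs fock"
  shows "hnorm fock (creation i x) = hnorm fock x"
proof -
  define z where "z k = (if k = i then x else 0)" for k
  have "(\<Sum>k\<in>{1..n}. creation k (z k)) = (\<Sum>k\<in>{1..n}. if k = i then creation i x else 0)"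
    by (rule sum.cong) (auto simp: z_def creation_zero)
  then have "(\<Sum>k\<in>{1..n}. creation k (z k)) = creation i x"
    using i by simp
  moreover have "(\<Sum>k\<in>{1..n}. (hnorm fock (z k))\<^sup>2) = (\<Sum>k\<in>{1..n}. if k = i then (hnorm fock x)\<^sup>2 else 0)"
    by (rule sum.cong) (auto simp: z_def)
  ultimately have "(hnorm fock (creation i x))\<^sup>2 = (hnorm fock x)\<^sup>2"
    using row_creation_isometric [of z] i x by (simp add: z_def)
  then show ?thesis
    using i x by (simp add: creation_mem)
qed

lemma creation_bounded:
  assumes i: "i \<in> {1..n}"
  shows "bounded_operator fock (creation i)"
proof (rule fock.bounded_operatorI)
  fix x y c
  assume x: "x \<in> vecs fock"
  show "creation i x \<in> vecs fock"
    using i x by (rule creation_mem)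
  show "hnorm fock (creation i x) \<le> 1 * hnorm fock x"
    using creation_isometric [OF i x] by simp
  show "creation i (scl fock c x) = scl fock c (creation i x)"
    using x by (auto simp: creation_def H.bounded_operator_scl [OF A_bounded [OF i]] fock_mem split: list.split)
  assume y: "y \<in> vecs fock"
  show "creation i (x + y) = creation i x + creation i y"
    using x y by (auto simp: creation_def H.bounded_operator_add [OF A_bounded [OF i]] fock_mem split: list.split)
qed

text \<open>
  The function \<open>f \<circ> \<sigma>\<^sub>a\<^sub>1 \<circ> \<dots> \<circ> \<sigma>\<^sub>a\<^sub>k\<close> for the word \<open>a\<^sub>1 \<dots> a\<^sub>k\<close>. Recursion on the first letter
  matches the shift \<open>creation\<close>; the description by the last letter, \<open>word_pullback_snoc\<close>,
  matches the defect form.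
\<close>

primrec word_pullback :: "nat list \<Rightarrow> ('x \<Rightarrow> complex) \<Rightarrow> 'x \<Rightarrow> complex" where
  "word_pullback [] f = f"
| "word_pullback (a # w) f = word_pullback w (pullback X f (\<sigma> a))"

lemma word_pullback_snoc: "word_pullback (w @ [j]) f = pullback X (word_pullback w f) (\<sigma> j)"
  by (induction w arbitrary: f) simp_all

lemma word_pullback_C0: "\<lbrakk>f \<in> C0 X; set w \<subseteq> {1..n}\<rbrakk> \<Longrightarrow> word_pullback w f \<in> C0 X"
  by (induction w arbitrary: f) (simp_all add: pullback_C0)

lemma word_pullback_pointwise:
  "word_pullback w (\<lambda>t. f t + g t) = (\<lambda>t. word_pullback w f t + word_pullback w g t)"
  "word_pullback w (\<lambda>t. f t * g t) = (\<lambda>t. word_pullback w f t * word_pullback w g t)"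
  "word_pullback w (\<lambda>t. cnj (f t)) = (\<lambda>t. cnj (word_pullback w f t))"
  by (induction w rule: rev_induct) (auto simp: word_pullback_snoc pullback_def)

lemma word_pullback_scl: "word_pullback w (\<lambda>t. c * f t) = (\<lambda>t. c * word_pullback w f t)"
  by (induction w rule: rev_induct) (auto simp: word_pullback_snoc pullback_def)

text \<open>
  At words with letters outside \<open>{1..n}\<close> the pullback need not belong to \<open>C0 X\<close>, and nothing is known
  about \<open>\<pi>\<close>.
\<close>

definition fock_rep :: "('x \<Rightarrow> complex) \<Rightarrow> (nat list \<Rightarrow> 'h) \<Rightarrow> nat list \<Rightarrow> 'h" where
  "fock_rep f x v = (if set v \<subseteq> {1..n} then \<pi> (word_pullback v f) (x v) else 0)"

lemma fock_rep_mem: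
  assumes f: "f \<in> C0 X" and x: "x \<in> vecs fock"
  shows "fock_rep f x \<in> vecs fock"
proof (rule fock_memI)
  show "fock_rep f x v \<in> vecs H" for v
    using f x by (simp add: fock_rep_def pi_mem word_pullback_C0 fock_mem)
  show "finite {v. x v \<noteq> 0}"
    using x by (simp add: fock_def)
  show "v \<in> {v. x v \<noteq> 0}" if "fock_rep f x v \<noteq> 0" for v
    using that f
    by (auto simp: fock_rep_def H.bounded_operator_zero [OF pi_bounded] word_pullback_C0 split: if_splits)
  show "set v \<subseteq> {1..n}" if "fock_rep f x v \<noteq> 0" for v
    using that by (auto simp: fock_rep_def split: if_splits)
qed

lemma fock_rep_scl:
  assumes "f \<in> C0 X" "x \<in> vecs fock"
  shows "fock_rep (\<lambda>t. c * f t) x = scl fock c (fock_rep f x)"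
  using assms
  by (auto simp: fun_eq_iff fock_rep_def word_pullback_scl word_pullback_C0 fock_mem pi_scl)

lemma
  assumes "f \<in> C0 X" "g \<in> C0 X" "x \<in> vecs fock"
  shows fock_rep_add: "fock_rep (\<lambda>t. f t + g t) x = fock_rep f x + fock_rep g x"
    and fock_rep_mult: "fock_rep (\<lambda>t. f t * g t) x = fock_rep f (fock_rep g x)"
  using assms
  by (auto simp: fun_eq_iff fock_rep_def word_pullback_pointwise word_pullback_C0 fock_mem pi_add pi_mult)

lemma fock_rep_star:
  assumes f: "f \<in> C0 X" and x: "x \<in> vecs fock" and y: "y \<in> vecs fock"
  shows "ip fock (fock_rep f x) y = ip fock x (fock_rep (\<lambda>t. cnj (f t)) y)"
proof -
  let ?fc = "\<lambda>t. cnj (f t)"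
  have "defect (\<lambda>j. fock_rep f x (w @ [j])) (\<lambda>j. y (w @ [j]))
      = defect (\<lambda>j. x (w @ [j])) (\<lambda>j. fock_rep ?fc y (w @ [j]))" for w
  proof (cases "set w \<subseteq> {1..n}")
    case True
    have "defect (\<lambda>j. fock_rep f x (w @ [j])) (\<lambda>j. y (w @ [j]))
        = defect (\<lambda>j. \<pi> (pullback X (word_pullback w f) (\<sigma> j)) (x (w @ [j]))) (\<lambda>j. y (w @ [j]))"
      using True by (intro defect_cong) (simp_all add: fock_rep_def word_pullback_snoc)
    also have "\<dots> = defect (\<lambda>j. x (w @ [j]))
        (\<lambda>j. \<pi> (pullback X (\<lambda>t. cnj (word_pullback w f t)) (\<sigma> j)) (y (w @ [j])))"
      using f x y True by (intro defect_star word_pullback_C0 fock_mem)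
    also have "\<dots> = defect (\<lambda>j. x (w @ [j])) (\<lambda>j. fock_rep ?fc y (w @ [j]))"
      using True
      by (intro defect_cong refl)
        (simp add: fock_rep_def word_pullback_snoc, simp add: word_pullback_pointwise)
    finally show ?thesis .
  next
    case False
    then have "x (w @ [j]) = 0" "fock_rep f x (w @ [j]) = 0" for j
      using fock_support [OF x, of "w @ [j]"] by (auto simp: fock_rep_def)
    moreover have "fock_rep ?fc y (w @ [j]) \<in> vecs H" for j
      using fock_rep_mem [OF C0_cnj [OF f] y] by (rule fock_mem)
    ultimately show ?thesis
      using y by (simp add: defect_zero fock_mem)
  qed
  then show ?thesis
    using f x y by (simp add: ip_fock fock_rep_def pi_star fock_mem)
qed

lemma fock_rep_bounded:
  assumes f: "f \<in> C0 X"
  shows "bounded_operator fock (fock_rep f)"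
proof -
  obtain M where M: "0 < M" "\<And>t. cmod (f t) \<le> M"
    using C0_bounded [OF f] by blast
  show ?thesis
  proof (rule fock.bounded_operatorI)
    fix x y c
    assume x: "x \<in> vecs fock"
    show "fock_rep f x \<in> vecs fock"
      using f x by (rule fock_rep_mem)
    show "hnorm fock (fock_rep f x) \<le> M * hnorm fock x"
      by (rule fock.star_homomorphism_contractive [where X = X and T = fock_rep])
        (use f x M in \<open>simp_all add: fock_rep_mem fock_rep_add fock_rep_scl fock_rep_mult fock_rep_star\<close>)
    show "fock_rep f (scl fock c x) = scl fock c (fock_rep f x)"
      using f x by (auto simp: fock_rep_def fock_mem H.bounded_operator_scl [OF pi_bounded] word_pullback_C0)
    assume y: "y \<in> vecs fock"
    show "fock_rep f (x + y) = fock_rep f x + fock_rep f y"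
      using f x y by (auto simp: fock_rep_def fock_mem H.bounded_operator_add [OF pi_bounded] word_pullback_C0)
  qed
qed

lemma fock_rep_covariant:
  assumes f: "f \<in> C0 X" and i: "i \<in> {1..n}" and x: "x \<in> vecs fock"
  shows "fock_rep f (creation i x) = creation i (fock_rep (pullback X f (\<sigma> i)) x)"
proof
  fix v
  show "fock_rep f (creation i x) v = creation i (fock_rep (pullback X f (\<sigma> i)) x) v"
  proof (cases v)
    case Nil
    then show ?thesis
      using f i x by (simp add: fock_rep_def pi_covariant fock_mem)
  next
    case (Cons a w)
    then show ?thesis
      using f i by (auto simp: fock_rep_def H.bounded_operator_zero [OF pi_bounded] pullback_C0 word_pullback_C0)
  qed
qed

definition embed :: "'h \<Rightarrow> nat list \<Rightarrow> 'h" where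
  "embed h v = (if v = [] then h else 0)"

lemma embed_mem: "h \<in> vecs H \<Longrightarrow> embed h \<in> vecs fock"
  by (rule fock_memI [where S = "{[]}"]) (auto simp: embed_def split: if_splits)

lemma ip_embed:
  assumes "x \<in> vecs fock"
  shows "ip fock x (embed h) = ip H (x []) h"
  using assms by (simp add: ip_fock embed_def defect_zero fock_mem)

lemma fock_rep_embed:
  assumes "f \<in> C0 X"
  shows "fock_rep f (embed h) = embed (\<pi> f h)"
  using assms
  by (auto simp: fock_rep_def embed_def H.bounded_operator_zero [OF pi_bounded] word_pullback_C0)

end

section \<open>The dilation\<close>

text \<open>
  Pairs of an index and a word are coded by words, so that a sequence of functions on words becomes a
  single function on words.
\<close>

definition seq_coord :: "(nat list \<Rightarrow> 'h) \<Rightarrow> nat \<Rightarrow> nat list \<Rightarrow> 'h" where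
  "seq_coord b k w = b (list_decode (prod_encode (k, list_encode w)))"

definition seq_tuple :: "(nat \<Rightarrow> nat list \<Rightarrow> 'h) \<Rightarrow> nat list \<Rightarrow> 'h" where
  "seq_tuple s v = (case prod_decode (list_encode v) of (k, m) \<Rightarrow> s k (list_decode m))"

lemma seq_coord_tuple: "seq_coord (seq_tuple s) = s"
  by (intro ext) (simp add: seq_coord_def seq_tuple_def)

lemma seq_tuple_coord: "seq_tuple (seq_coord b) = b"
  by (intro ext) (simp add: seq_coord_def seq_tuple_def case_prod_unfold)

context covariant_representation
begin

sublocale C: completion fock seq_coord "seq_tuple :: (nat \<Rightarrow> nat list \<Rightarrow> 'h) \<Rightarrow> nat list \<Rightarrow> 'h"
  by unfold_locales (simp_all add: seq_coord_tuple seq_tuple_coord, simp add: seq_coord_def fun_eq_iff)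

definition J :: "'h \<Rightarrow> nat list \<Rightarrow> 'h" where
  "J h = C.incl (embed h)"

definition S :: "nat \<Rightarrow> (nat list \<Rightarrow> 'h) \<Rightarrow> nat list \<Rightarrow> 'h" where
  "S i = C.extension (creation i)"

definition \<rho> :: "('x \<Rightarrow> complex) \<Rightarrow> (nat list \<Rightarrow> 'h) \<Rightarrow> nat list \<Rightarrow> 'h" where
  "\<rho> f = C.extension (fock_rep f)"

lemma rho_cls: "\<lbrakk>f \<in> C0 X; fock.cauchy_seq s\<rbrakk> \<Longrightarrow> \<rho> f (C.cls s) = C.cls (\<lambda>k. fock_rep f (s k))"
  unfolding \<rho>_def by (intro C.extension_cls fock_rep_bounded)

lemma S_cls: "\<lbrakk>i \<in> {1..n}; fock.cauchy_seq s\<rbrakk> \<Longrightarrow> S i (C.cls s) = C.cls (\<lambda>k. creation i (s k))"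
  unfolding S_def by (intro C.extension_cls creation_bounded)

lemmas cauchy_fock_rep = fock.cauchy_seq_bounded_operator [OF fock_rep_bounded]
lemmas cauchy_creation = fock.cauchy_seq_bounded_operator [OF creation_bounded]

lemma J_mem: "h \<in> vecs H \<Longrightarrow> J h \<in> vecs C.cmpl"
  unfolding J_def by (intro C.incl_mem embed_mem)

lemma isometric_embedding_J: "isometric_embedding H C.cmpl J"
proof -
  have "J (x + y) = J x + J y" for x y
  proof -
    have "embed (x + y) = embed x + embed y"
      by (auto simp: embed_def)
    then show ?thesis
      by (simp add: J_def C.incl_def flip: C.cls_add)
  qed
  moreover have "J (scl H c x) = scl C.cmpl c (J x)" for c x
  proof -
    have "embed (scl H c x) = scl fock c (embed x)"
      by (auto simp: embed_def)
    then show ?thesis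
      by (simp add: J_def C.incl_def flip: C.cls_scl)
  qed
  moreover have "ip C.cmpl (J x) (J y) = ip H x y" if "x \<in> vecs H" "y \<in> vecs H" for x y
    using that by (simp add: J_def C.ip_incl embed_mem ip_embed) (simp add: embed_def)
  ultimately show ?thesis
    by (simp add: isometric_embedding_def linear_between_def J_mem)
qed

lemma star_representation_rho: "star_representation X C.cmpl \<rho>"
  unfolding star_representation_def
proof (intro conjI ballI allI)
  fix f
  assume f: "f \<in> C0 X"
  show "bounded_operator C.cmpl (\<rho> f)"
    unfolding \<rho>_def by (intro C.bounded_operator_extension fock_rep_bounded f)
  fix x
  assume "x \<in> vecs C.cmpl"
  then obtain s where s: "fock.cauchy_seq s" "x = C.cls s"
    by (meson C.cmpl_cases)
  have sk: "s k \<in> vecs fock" for k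
    using s(1) by (rule fock.cauchy_seq_mem)
  show "\<rho> (\<lambda>t. c * f t) x = scl C.cmpl c (\<rho> f x)" for c
    using C0_scl [OF f] f s sk by (simp add: rho_cls fock_rep_scl flip: C.cls_scl)
  show "ip C.cmpl (\<rho> f x) y = ip C.cmpl x (\<rho> (\<lambda>t. cnj (f t)) y)" if y: "y \<in> vecs C.cmpl" for y
  proof -
    obtain t where t: "fock.cauchy_seq t" "y = C.cls t"
      using y by (meson C.cmpl_cases)
    have "(\<lambda>k. ip fock (fock_rep f (s k)) (t k)) \<longlonglongrightarrow> ip C.cmpl x (\<rho> (\<lambda>t. cnj (f t)) y)"
      using C.ip_cls [OF s(1) cauchy_fock_rep [OF C0_cnj [OF f] t(1)]] f t sk
      by (simp add: s rho_cls C0_cnj fock_rep_star fock.cauchy_seq_mem)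
    then show ?thesis
      unfolding s t rho_cls [OF f s(1)]
      by (intro C.ip_cls_eq cauchy_fock_rep f s t)
  qed
  fix g
  assume g: "g \<in> C0 X"
  show "\<rho> (\<lambda>t. f t + g t) x = \<rho> f x + \<rho> g x"
    using C0_add [OF f g] f g s sk by (simp add: rho_cls fock_rep_add flip: C.cls_add)
  show "\<rho> (\<lambda>t. f t * g t) x = \<rho> f (\<rho> g x)"
    using C0_mult [OF f g] f g s sk by (simp add: rho_cls fock_rep_mult cauchy_fock_rep)
qed

lemma covariant_S: "covariant X n \<sigma> C.cmpl \<rho> S"
  unfolding covariant_def
proof (intro ballI)
  fix f i x
  assume f: "f \<in> C0 X" and i: "i \<in> {1..n}" and "x \<in> vecs C.cmpl"
  then obtain s where s: "fock.cauchy_seq s" "x = C.cls s"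
    by (meson C.cmpl_cases)
  then show "\<rho> f (S i x) = S i (\<rho> (pullback X f (\<sigma> i)) x)"
    using cauchy_creation [OF i s(1)] cauchy_fock_rep [OF pullback_C0 [OF f i] s(1)]
    by (simp add: S_cls [OF i] rho_cls f pullback_C0 [OF f i] fock_rep_covariant [OF f i] fock.cauchy_seq_mem)
qed

lemma row_isometry_S: "row_isometry C.cmpl n S"
  unfolding row_isometry_def
proof (intro conjI ballI)
  show "bounded_operator C.cmpl (S i)" if "i \<in> {1..n}" for i
    unfolding S_def using that by (intro C.bounded_operator_extension creation_bounded)
  fix x
  assume x: "x \<in> {1..n} \<rightarrow> vecs C.cmpl"
  define s where "s i = seq_coord (x i)" for i
  have s: "fock.cauchy_seq (s i)" "x i = C.cls (s i)" if "i \<in> {1..n}" for i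
    using x that C.cmpl_cases [of "x i"] unfolding s_def by (metis Pi_mem)+
  have sk: "s i k \<in> vecs fock" if "i \<in> {1..n}" for i k
    using s(1) [OF that] by (rule fock.cauchy_seq_mem)
  let ?y = "\<lambda>k. \<Sum>i\<in>{1..n}. creation i (s i k)"
  have y: "fock.cauchy_seq ?y"
  proof -
    have "fock.cauchy_seq (\<lambda>k. \<Sum>i\<in>I. creation i (s i k))" if "I \<subseteq> {1..n}" "finite I" for I
      using that(2,1)
    proof (induction I)
      case empty
      show ?case unfolding sum.empty by (intro fock.cauchy_seq_const fock.zero_mem)
    next
      case (insert i I)
      then show ?case
        unfolding sum.insert [OF insert.hyps]
        by (intro fock.cauchy_seq_add cauchy_creation s) auto
    qed
    from this [of "{1..n}"] show ?thesis by simp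
  qed
  have "row_apply n S x = (\<Sum>i\<in>{1..n}. C.cls (\<lambda>k. creation i (s i k)))"
    unfolding row_apply_def using s S_cls by (intro sum.cong) metis+
  also have "\<dots> = C.cls ?y"
    by (rule C.cls_sum [symmetric])
  finally have row: "row_apply n S x = C.cls ?y" .
  have "(\<lambda>k. hnorm fock (?y k)) = (\<lambda>k. sqrt (\<Sum>i\<in>{1..n}. (hnorm fock (s i k))\<^sup>2))"
  proof
    fix k
    have "(hnorm fock (?y k))\<^sup>2 = (\<Sum>i\<in>{1..n}. (hnorm fock (s i k))\<^sup>2)"
      using sk by (rule row_creation_isometric)
    then show "hnorm fock (?y k) = sqrt (\<Sum>i\<in>{1..n}. (hnorm fock (s i k))\<^sup>2)"
      using fock.cauchy_seq_mem [OF y] by (simp add: real_sqrt_unique)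
  qed
  moreover have "(\<lambda>k. sqrt (\<Sum>i\<in>{1..n}. (hnorm fock (s i k))\<^sup>2))
      \<longlonglongrightarrow> sqrt (\<Sum>i\<in>{1..n}. (hnorm C.cmpl (C.cls (s i)))\<^sup>2)"
    using s by (intro tendsto_intros C.hnorm_cls) auto
  ultimately have "hnorm C.cmpl (C.cls ?y) = sqrt (\<Sum>i\<in>{1..n}. (hnorm C.cmpl (C.cls (s i)))\<^sup>2)"
    using C.hnorm_cls [OF y] by (simp only: LIMSEQ_unique)
  also have "\<dots> = column_norm C.cmpl n x"
    unfolding column_norm_def using s(2) by (intro arg_cong [where f = sqrt] sum.cong) auto
  finally show "hnorm C.cmpl (row_apply n S x) = column_norm C.cmpl n x"
    by (simp only: row)
qed

lemma rho_J: "\<lbrakk>f \<in> C0 X; h \<in> vecs H\<rbrakk> \<Longrightarrow> \<rho> f (J h) = J (\<pi> f h)"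
  by (simp add: \<rho>_def J_def C.extension_incl fock_rep_bounded embed_mem fock_rep_embed)

lemma ip_cls_J:
  assumes s: "fock.cauchy_seq s" and h: "h \<in> vecs H"
  shows "(\<lambda>k. ip H (s k []) h) \<longlonglongrightarrow> ip C.cmpl (C.cls s) (J h)"
  using C.ip_cls [OF s fock.cauchy_seq_const [OF embed_mem [OF h]]] s
  by (simp add: J_def C.incl_def ip_embed fock.cauchy_seq_mem)

lemma hnorm_vacuum_le:
  assumes x: "x \<in> vecs fock"
  shows "hnorm H (x []) \<le> hnorm fock x"
proof -
  have "0 \<le> Re (Sum_any (\<lambda>w. defect (\<lambda>j. x (w @ [j])) (\<lambda>j. x (w @ [j]))))"
    using x by (simp add: Sum_any.expand_set defect_nonneg fock_mem sum_nonneg)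
  then show ?thesis
    by (simp add: hnorm_def ip_fock)
qed

text \<open>
  The components in \<open>H\<close> form a Cauchy sequence that tends weakly to \<open>0\<close>, hence in norm: if \<open>L\<close> is the
  limit of the norms, then splitting \<open>\<langle>s k [], s k []\<rangle>\<close> at \<open>s N []\<close> gives \<open>L\<^sup>2 \<le> e L\<close> for every
  \<open>e > 0\<close>.
\<close>

lemma vacuum_null:
  assumes s: "fock.cauchy_seq s" and orth: "C.cls s \<in> orth_compl C.cmpl (J ` vecs H)"
  shows "(\<lambda>k. hnorm H (s k [])) \<longlonglongrightarrow> 0"
proof -
  have sk: "s k \<in> vecs fock" "s k [] \<in> vecs H" for k
    using fock.cauchy_seq_mem [OF s] fock_mem by auto
  have lim: "(\<lambda>k. ip H (s k []) h) \<longlonglongrightarrow> 0" if "h \<in> vecs H" for h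
    using ip_cls_J [OF s that] orth that by (simp add: orth_compl_def)
  have "H.cauchy_seq (\<lambda>k. s k [])"
  proof (rule H.cauchy_seqI)
    show "hnorm H (s m [] - s k []) \<le> hnorm fock (s m - s k)" for m k
      using hnorm_vacuum_le [of "s m - s k"] sk by simp
  qed (use s sk in \<open>auto simp: fock.cauchy_seq_def\<close>)
  then obtain L where L: "(\<lambda>k. hnorm H (s k [])) \<longlonglongrightarrow> L"
    using H.convergent_hnorm unfolding convergent_def by blast
  have L0: "0 \<le> L"
    by (rule LIMSEQ_le_const [OF L]) (use sk in auto)
  have "L\<^sup>2 \<le> e * L" if e: "0 < e" for e
  proof -
    obtain N where N: "\<forall>m\<ge>N. \<forall>k\<ge>N. hnorm H (s m [] - s k []) < e"
      using \<open>H.cauchy_seq (\<lambda>k. s k [])\<close> e unfolding H.cauchy_seq_def by blast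
    have "(\<lambda>k. (hnorm H (s k []))\<^sup>2 - Re (ip H (s k []) (s N []))) \<longlonglongrightarrow> L\<^sup>2 - Re 0"
      by (intro tendsto_intros L lim sk)
    then have "L\<^sup>2 - Re 0 \<le> e * L"
    proof (rule LIMSEQ_le)
      show "(\<lambda>k. e * hnorm H (s k [])) \<longlonglongrightarrow> e * L"
        by (intro tendsto_intros L)
      have "(hnorm H (s k []))\<^sup>2 - Re (ip H (s k []) (s N [])) \<le> e * hnorm H (s k [])" if "N \<le> k" for k
      proof -
        have "(hnorm H (s k []))\<^sup>2 - Re (ip H (s k []) (s N [])) = Re (ip H (s k []) (s k [] - s N []))"
          using sk by (simp add: H.hnorm_sq H.ip_diff_right)
        also have "\<dots> \<le> hnorm H (s k []) * hnorm H (s k [] - s N [])"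
          using H.cauchy_schwarz [of "s k []" "s k [] - s N []"] sk
            complex_Re_le_cmod [of "ip H (s k []) (s k [] - s N [])"] by simp
        also have "\<dots> \<le> hnorm H (s k []) * e"
          using N that sk by (intro mult_left_mono) (auto simp: less_imp_le)
        finally show ?thesis by (simp add: mult.commute)
      qed
      then show "\<exists>M. \<forall>k\<ge>M. (hnorm H (s k []))\<^sup>2 - Re (ip H (s k []) (s N [])) \<le> e * hnorm H (s k [])"
        by blast
    qed
    then show ?thesis by simp
  qed
  from this [of "L / 2"] L0 have "L = 0"
    by (cases "L = 0") (auto simp: power2_eq_square)
  with L show ?thesis by simp
qed

text \<open>
  The component of \<open>creation i x\<close> in \<open>H\<close> is \<open>A i (x [])\<close>, so it depends on that of \<open>x\<close> alone, and
  boundedly.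
\<close>

lemma orth_compl_invariant_S:
  assumes i: "i \<in> {1..n}"
  shows "invariant_under (orth_compl C.cmpl (J ` vecs H)) (S i)"
  unfolding invariant_under_def
proof
  fix y
  assume "y \<in> S i ` orth_compl C.cmpl (J ` vecs H)"
  then obtain x where x: "x \<in> orth_compl C.cmpl (J ` vecs H)" "y = S i x"
    by blast
  then obtain s where s: "fock.cauchy_seq s" "x = C.cls s"
    by (metis (no_types, lifting) C.cmpl_cases mem_Collect_eq orth_compl_def)
  have sk: "s k \<in> vecs fock" "s k [] \<in> vecs H" for k
    using fock.cauchy_seq_mem [OF s(1)] fock_mem by auto
  have "H.null_seq (\<lambda>k. s k [])"
    using vacuum_null [OF s(1)] x s sk by (simp add: H.null_seq_def)
  from H.null_seq_bounded_operator [OF A_bounded [OF i] this]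
  have null: "H.null_seq (\<lambda>k. A i (s k []))" .
  have "ip C.cmpl y (J h) = 0" if h: "h \<in> vecs H" for h
  proof -
    have "(\<lambda>k. ip H (A i (s k [])) h) \<longlonglongrightarrow> ip C.cmpl y (J h)"
      using ip_cls_J [OF cauchy_creation [OF i s(1)] h] by (simp add: x s S_cls [OF i])
    moreover have "(\<lambda>k. ip H (A i (s k [])) h) \<longlonglongrightarrow> 0"
      using H.null_seq_ip(1) [OF null H.cauchy_seq_const [OF h]] .
    ultimately show ?thesis
      by (rule LIMSEQ_unique)
  qed
  moreover have "y \<in> vecs C.cmpl"
    unfolding x s S_cls [OF i s(1)] by (intro C.cls_mem cauchy_creation i s)
  ultimately show "y \<in> orth_compl C.cmpl (J ` vecs H)"
    by (auto simp: orth_compl_def)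
qed

lemma orth_compl_invariant_rho:
  assumes f: "f \<in> C0 X"
  shows "invariant_under (orth_compl C.cmpl (J ` vecs H)) (\<rho> f)"
proof -
  have "bounded_operator C.cmpl (\<rho> f)"
    and "\<And>x y. \<lbrakk>x \<in> vecs C.cmpl; y \<in> vecs C.cmpl\<rbrakk>
           \<Longrightarrow> ip C.cmpl (\<rho> f x) y = ip C.cmpl x (\<rho> (\<lambda>t. cnj (f t)) y)"
    using star_representation_rho f by (simp_all add: star_representation_def)
  then show ?thesis
    using C0_cnj [OF f]
    by (auto simp: invariant_under_def orth_compl_def J_mem rho_J pi_mem C.cmpl.bounded_operator_mem)
qed

lemma orth_proj_S_J:
  assumes i: "i \<in> {1..n}" and h: "h \<in> vecs H"
  shows "orth_proj C.cmpl (J ` vecs H) (S i (J h)) = J (A i h)"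
  unfolding orth_proj_def
proof (rule the_equality)
  let ?x = "S i (J h)"
  have SJ: "?x = C.incl (creation i (embed h))"
    unfolding S_def J_def by (intro C.extension_incl creation_bounded embed_mem i h)
  have cm: "creation i (embed h) \<in> vecs fock"
    by (intro creation_mem embed_mem i h)
  have ip_SJ: "ip C.cmpl ?x (J k) = ip C.cmpl (J (A i h)) (J k)" if "k \<in> vecs H" for k
    using that h A_mem [OF i h] unfolding SJ
    by (simp add: J_def C.ip_incl cm embed_mem ip_embed) (simp add: embed_def)
  have mem: "?x \<in> vecs C.cmpl" "J (A i h) \<in> vecs C.cmpl"
    using cm A_mem [OF i h] by (simp_all add: SJ C.incl_mem J_mem)
  show "J (A i h) \<in> J ` vecs H \<and> ?x - J (A i h) \<in> orth_compl C.cmpl (J ` vecs H)"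
    using mem A_mem [OF i h] by (auto simp: orth_compl_def C.cmpl.ip_diff J_mem ip_SJ)
  fix y
  assume "y \<in> J ` vecs H \<and> ?x - y \<in> orth_compl C.cmpl (J ` vecs H)"
  then obtain k where k: "k \<in> vecs H" "y = J k" and orth: "?x - J k \<in> orth_compl C.cmpl (J ` vecs H)"
    by blast
  have "ip C.cmpl (J (A i h) - J k) (J l) = 0" if l: "l \<in> vecs H" for l
  proof -
    have "ip C.cmpl (?x - J k) (J l) = 0"
      using orth l by (auto simp: orth_compl_def)
    then show ?thesis
      using mem k l by (simp add: C.cmpl.ip_diff J_mem ip_SJ)
  qed
  from this [OF A_mem [OF i h]] this [OF k(1)]
  have "ip C.cmpl (J (A i h) - J k) (J (A i h) - J k) = 0"
    using mem k by (simp add: C.cmpl.ip_diff_right J_mem)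
  then have "J (A i h) - J k = 0"
    using mem k by (intro C.cmpl_definite) (simp_all add: J_mem hnorm_def)
  then show "y = J (A i h)"
    by (simp add: k)
qed

end

theorem theorem2p1:
  fixes X :: "'x topology" and n :: nat and \<sigma> :: "nat \<Rightarrow> 'x \<Rightarrow> 'x"
    and H :: "'h::ab_group_add hilbert"
    and \<pi> :: "('x \<Rightarrow> complex) \<Rightarrow> 'h \<Rightarrow> 'h"
    and A :: "nat \<Rightarrow> 'h \<Rightarrow> 'h"
  assumes "multivariable_dynamical_system X n \<sigma>"
    and "complex_hilbert_space H"
    and "star_representation X H \<pi>"
    and "row_contraction H n A"
    and "covariant X n \<sigma> H \<pi> A"
  shows "\<exists>(K :: (nat list \<Rightarrow> 'h) hilbert) J \<rho> S.
           complex_hilbert_space K \<and> isometric_embedding H K J \<and>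
           star_representation X K \<rho> \<and> row_isometry K n S \<and>
           covariant X n \<sigma> K \<rho> S \<and>
           (\<forall>f\<in>C0 X. invariant_under (J ` vecs H) (\<rho> f) \<and>
                      invariant_under (orth_compl K (J ` vecs H)) (\<rho> f) \<and>
                      (\<forall>h\<in>vecs H. \<rho> f (J h) = J (\<pi> f h))) \<and>
           (\<forall>i\<in>{1..n}. invariant_under (orth_compl K (J ` vecs H)) (S i) \<and>
                        (\<forall>h\<in>vecs H. orth_proj K (J ` vecs H) (S i (J h)) = J (A i h)))"
proof -
  interpret covariant_representation X n \<sigma> H \<pi> A
    using assms by (intro covariant_representation.intro covariant_representation_axioms.intro)
  have "invariant_under (J ` vecs H) (\<rho> f)" if "f \<in> C0 X" for f
    using that by (auto simp: invariant_under_def rho_J pi_mem)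
  then show ?thesis
    using C.complex_hilbert_space_cmpl isometric_embedding_J star_representation_rho row_isometry_S
      covariant_S orth_compl_invariant_rho orth_compl_invariant_S rho_J orth_proj_S_J
    by (intro exI [of _ C.cmpl] exI [of _ J] exI [of _ \<rho>] exI [of _ S]) simp
qed

end
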